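(* Let $q$ be an odd prime power and let $Q^+(7,q)$ be the hyperbolic quadric in $\mathrm{PG}(7,q)$. Then there exist $(q+1)$-ovoids of $Q^+(7,q)$ of the form $\mathcal{O}_1\cup\mathcal{O}_2$, where for two distinct elliptic quadrics $\mathcal{Q}_1\neq\mathcal{Q}_2$ of type $Q^-(5,q)$ contained in $Q^+(7,q)$, the set $\mathcal{O}_i$ is a $\frac{q+1}{2}$-ovoid of $\mathcal{Q}_i$ for $i=1,2$.
   Context: $Q^+(7,q)$ is the set of points of $\mathrm{PG}(7,q)$ that are zeros of a non-singular quadratic form on $\mathbb{F}_q^8$ of Witt index $4$, e.g. $X_0X_1+X_2X_3+X_4X_5+X_6X_7$. Its generators are the maximal totally singular subspaces, which are projective $3$-spaces. $Q^-(5,q)$ is the quadric of a non-singular quadratic form on $\mathbb{F}_q^6$ of Witt index $2$ (elliptic); its generators are lines. An elliptic quadric $Q^-(5,q)$ contained in $Q^+(7,q)$ means the intersection of $Q^+(7,q)$ with a projective $5$-space of $\mathrm{PG}(7,q)$ on which the restricted quadratic form is non-singular of Witt index $2$. An $m$-ovoid of a quadric is a set of points of the quadric meeting every generator of that quadric in exactly $m$ points. *)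

theory Defs
  imports "HOL-Analysis.Analysis"
begin

text \<open>
  The ambient space is the vector space \<open>F\<^sup>n\<close>, rendered as \<open>'a ^ 'n\<close> over a finite field \<open>'a\<close>.
  A projective subspace of projective dimension \<open>d\<close> is a linear subspace of vector dimension
  \<open>d + 1\<close>; in particular a point is a one-dimensional linear subspace.
\<close>

definition polar_form :: "('a::field ^ 'n \<Rightarrow> 'a) \<Rightarrow> 'a ^ 'n \<Rightarrow> 'a ^ 'n \<Rightarrow> 'a" where
  "polar_form Q x y = Q (x + y) - Q x - Q y"

text \<open>The polar form is symmetric by definition, so linearity in the first argument is enough.\<close>

definition quadratic_form :: "('a::field ^ 'n \<Rightarrow> 'a) \<Rightarrow> bool" where
  "quadratic_form Q \<longleftrightarrow>
     (\<forall>c x. Q (c *s x) = c\<^sup>2 * Q x) \<and>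
     (\<forall>x y z. polar_form Q (x + y) z = polar_form Q x z + polar_form Q y z) \<and>
     (\<forall>c x z. polar_form Q (c *s x) z = c * polar_form Q x z)"

definition nonsingular_on :: "('a::field ^ 'n \<Rightarrow> 'a) \<Rightarrow> ('a ^ 'n) set \<Rightarrow> bool" where
  "nonsingular_on Q W \<longleftrightarrow>
     (\<forall>v\<in>W. Q v = 0 \<and> (\<forall>w\<in>W. polar_form Q v w = 0) \<longrightarrow> v = 0)"

definition totally_singular :: "('a::field ^ 'n \<Rightarrow> 'a) \<Rightarrow> ('a ^ 'n) set \<Rightarrow> bool" where
  "totally_singular Q U \<longleftrightarrow> vec.subspace U \<and> (\<forall>u\<in>U. Q u = 0)"

definition witt_index :: "('a::field ^ 'n \<Rightarrow> 'a) \<Rightarrow> ('a ^ 'n) set \<Rightarrow> nat" where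
  "witt_index Q W = Max {vec.dim U |U. U \<subseteq> W \<and> totally_singular Q U}"

definition proj_points :: "('a::field ^ 'n) set \<Rightarrow> ('a ^ 'n) set set" where
  "proj_points W = {P. P \<subseteq> W \<and> vec.subspace P \<and> vec.dim P = 1}"

text \<open>The points of the quadric that the restriction of \<open>Q\<close> defines in the subspace \<open>W\<close>.\<close>

definition quadric :: "('a::field ^ 'n \<Rightarrow> 'a) \<Rightarrow> ('a ^ 'n) set \<Rightarrow> ('a ^ 'n) set set" where
  "quadric Q W = {P \<in> proj_points W. \<forall>v\<in>P. Q v = 0}"

definition generators :: "('a::field ^ 'n \<Rightarrow> 'a) \<Rightarrow> ('a ^ 'n) set \<Rightarrow> ('a ^ 'n) set set" where
  "generators Q W =
     {G. G \<subseteq> W \<and> totally_singular Q G \<and>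
         (\<forall>U. G \<subseteq> U \<and> U \<subseteq> W \<and> totally_singular Q U \<longrightarrow> U = G)}"

definition is_ovoid ::
  "nat \<Rightarrow> ('a::field ^ 'n \<Rightarrow> 'a) \<Rightarrow> ('a ^ 'n) set \<Rightarrow> ('a ^ 'n) set set \<Rightarrow> bool" where
  "is_ovoid m Q W S \<longleftrightarrow>
     S \<subseteq> quadric Q W \<and> (\<forall>G\<in>generators Q W. card (S \<inter> proj_points G) = m)"

text \<open>\<open>Q\<close> defines a hyperbolic quadric \<open>Q\<^sup>+(7,q)\<close>.\<close>

definition hyperbolic_form :: "('a::field ^ 8 \<Rightarrow> 'a) \<Rightarrow> bool" where
  "hyperbolic_form Q \<longleftrightarrow>
     quadratic_form Q \<and> nonsingular_on Q UNIV \<and> witt_index Q UNIV = 4"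

text \<open>\<open>W\<close> is a projective 5-space that meets the quadric of \<open>Q\<close> in an elliptic \<open>Q\<^sup>-(5,q)\<close>.\<close>

definition elliptic_section :: "('a::field ^ 'n \<Rightarrow> 'a) \<Rightarrow> ('a ^ 'n) set \<Rightarrow> bool" where
  "elliptic_section Q W \<longleftrightarrow>
     vec.subspace W \<and> vec.dim W = 6 \<and> nonsingular_on Q W \<and> witt_index Q W = 2"

end

theory Submission
  imports Defs
begin

text \<open>
  Let \<open>K = F\<^sub>q(\<epsilon>)\<close> be the quadratic extension, where \<open>\<epsilon>\<close> is a nonsquare of \<open>K\<close>, and let \<open>\<phi>(x) = x\<^sub>2\<^sup>2 - x\<^sub>1 x\<^sub>3\<close>
  on \<open>K\<^sup>3\<close>. Composing \<open>\<phi>\<close> with an \<open>F\<^sub>q\<close>-linear functional with kernel \<open>F\<^sub>q \<epsilon>\<close> gives an elliptic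
  form on \<open>F\<^sub>q\<^sup>6\<close>. Its singular points are those with \<open>\<phi>(x) \<in> F\<^sub>q \<epsilon>\<close>. Take the points for which
  \<open>\<phi>(x) / \<epsilon>\<close> is a nonzero square of \<open>F\<^sub>q\<close>, and the points \<open>u (r\<^sup>2, r s, s\<^sup>2)\<close> of the conic for which
  \<open>u\<close> is a square of \<open>K\<close>: this is a \<open>(q + 1)/2\<close>-ovoid, and so is the complement.

  A generator of \<open>Q\<^sup>+(7,q)\<close> meets the 5-space of an elliptic section in a generator of that section,
  so an \<open>m\<close>-ovoid of an elliptic section is an \<open>m\<close>-ovoid of \<open>Q\<^sup>+(7,q)\<close>, and it suffices to find disjoint
  ones in two sections. Two embeddings of \<open>K\<^sup>3\<close> that take equal values only at equal arguments
  send the ovoid and its complement to disjoint sets.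
\<close>

section \<open>Squares in finite fields of odd order\<close>

definition is_sq :: "'a::semiring_1 \<Rightarrow> bool" where
  "is_sq x \<longleftrightarrow> (\<exists>y. x = y\<^sup>2)"

lemma is_sq_mult_square_iff:
  fixes c x :: "'a::field"
  assumes "c \<noteq> 0"
  shows "is_sq (c\<^sup>2 * x) \<longleftrightarrow> is_sq x"
proof
  assume "is_sq (c\<^sup>2 * x)"
  then obtain y where "c\<^sup>2 * x = y\<^sup>2" by (auto simp: is_sq_def)
  then have "x = (y / c)\<^sup>2" using assms by (simp add: field_simps)
  then show "is_sq x" by (auto simp: is_sq_def)
next
  assume "is_sq x"
  then show "is_sq (c\<^sup>2 * x)" unfolding is_sq_def by (metis power_mult_distrib)
qed

text \<open>Translation by 1 permutes the field, so comparing the two sums gives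
  \<open>of_nat CARD('a) = 0\<close>. With \<open>2 = 0\<close> and an odd cardinality this would
  read \<open>1 = 0\<close>.\<close>

lemma two_neq_zero_of_odd_card:
  assumes "odd CARD('a::{field,finite})"
  shows "(2::'a) \<noteq> 0"
proof
  assume 2: "(2::'a) = 0"
  have "(\<Sum>x\<in>UNIV. x) = (\<Sum>x\<in>UNIV. x + 1 :: 'a)"
    by (rule sum.reindex_bij_witness[of _ "\<lambda>x. x + 1" "\<lambda>x. x - 1"]) auto
  then have "of_nat CARD('a) = (0::'a)" by (simp add: sum.distrib)
  moreover obtain k where "CARD('a) = 2 * k + 1" using assms by (elim oddE)
  ultimately show False using 2 by simp
qed

locale odd_finite_field =
  fixes ty :: "'a::{field,finite} itself"
  assumes two_neq_zero: "(2::'a) \<noteq> 0"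
begin

lemma neq_uminus: "x \<noteq> - x" if "x \<noteq> 0" for x :: 'a
proof
  assume "x = - x"
  then have "2 * x = 0" by (metis mult_2 add.right_inverse)
  then show False using that two_neq_zero by simp
qed

text \<open>Squaring is two-to-one on the nonzero elements, because \<open>r\<close> and
  \<open>- r\<close> differ.\<close>

lemma card_nonzero_squares: "2 * card {x::'a. x \<noteq> 0 \<and> is_sq x} = CARD('a) - 1"
proof -
  let ?S = "{x::'a. x \<noteq> 0 \<and> is_sq x}"
  have "card (UNIV - {0::'a}) = card (\<Union>s\<in>?S. {x. x\<^sup>2 = s})"
    by (rule arg_cong[where f=card]) (auto simp: is_sq_def)
  also have "\<dots> = (\<Sum>s\<in>?S. card {x. x\<^sup>2 = s})"
    by (rule card_UN_disjoint) auto
  also have "\<dots> = (\<Sum>s\<in>?S. 2)"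
  proof (rule sum.cong)
    fix s assume "s \<in> ?S"
    then obtain r where r: "s = r\<^sup>2" "r \<noteq> 0" by (auto simp: is_sq_def)
    then have "{x. x\<^sup>2 = s} = {r, - r}" by (auto simp: power2_eq_iff)
    then show "card {x. x\<^sup>2 = s} = 2" using neq_uminus[OF r(2)] by simp
  qed simp
  finally show ?thesis by simp
qed

lemma card_squares: "2 * card {x::'a. is_sq x} = CARD('a) + 1"
proof -
  have "{x::'a. is_sq x} = insert 0 {x. x \<noteq> 0 \<and> is_sq x}" by (auto simp: is_sq_def)
  then have "card {x::'a. is_sq x} = Suc (card {x::'a. x \<noteq> 0 \<and> is_sq x})" by simp
  moreover have "CARD('a) \<ge> 1" by (simp add: Suc_leI)
  ultimately show ?thesis using card_nonzero_squares by simp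
qed

lemma ex_nonsquare: "\<exists>n::'a. \<not> is_sq n"
proof (rule ccontr)
  assume "\<not> ?thesis"
  then have "{x::'a. is_sq x} = UNIV" by auto
  then have "2 * CARD('a) = CARD('a) + 1" using card_squares by simp
  moreover have "card {0, 1::'a} \<le> CARD('a)" by (rule card_mono) auto
  ultimately show False by simp
qed

text \<open>Multiplication by \<open>m\<close> maps the nonzero squares injectively into the
  nonsquares. There are equally many of both, so \<open>n\<close> is \<open>m\<close> times a
  square.\<close>

lemma is_sq_mult_nonsquares:
  fixes m n :: 'a
  assumes m: "\<not> is_sq m" and n: "\<not> is_sq n"
  shows "is_sq (m * n)"
proof -
  let ?S = "{x::'a. x \<noteq> 0 \<and> is_sq x}" and ?N = "{x::'a. \<not> is_sq x}"
  have m0: "m \<noteq> 0" using m by (auto simp: is_sq_def)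
  have inj: "inj_on ((*) m) A" for A using m0 by (auto simp: inj_on_def)
  have "(*) m ` ?S \<subseteq> ?N"
  proof clarify
    fix s assume "s \<noteq> 0" "is_sq s" "is_sq (m * s)"
    then obtain r where "s = r\<^sup>2" "r \<noteq> 0" by (auto simp: is_sq_def)
    then show False using m \<open>is_sq (m * s)\<close> is_sq_mult_square_iff[of r m] by (simp add: mult.commute)
  qed
  moreover have "card ((*) m ` ?S) = card ?N"
  proof -
    have "?N = UNIV - {x. is_sq x}" by auto
    then have "card ?N = CARD('a) - card {x::'a. is_sq x}" by (simp add: card_Diff_subset)
    then show ?thesis using card_nonzero_squares card_squares by (simp add: card_image[OF inj])
  qed
  ultimately have "(*) m ` ?S = ?N" by (intro card_subset_eq) auto
  then obtain s where "s \<noteq> 0" "is_sq s" "n = m * s" using n by blast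
  then obtain r where "n = m * r\<^sup>2" by (auto simp: is_sq_def)
  then have "m * n = (m * r)\<^sup>2" by (simp add: power2_eq_square)
  then show ?thesis by (auto simp: is_sq_def)
qed

lemma is_sq_mult_iff:
  fixes x y :: 'a
  assumes "x \<noteq> 0" "y \<noteq> 0"
  shows "is_sq (x * y) \<longleftrightarrow> (is_sq x \<longleftrightarrow> is_sq y)"
proof (cases "is_sq x")
  case True
  then obtain r where "x = r\<^sup>2" by (auto simp: is_sq_def)
  then show ?thesis using assms True is_sq_mult_square_iff[of r y] by auto
next
  case x: False
  show ?thesis
  proof (cases "is_sq y")
    case True
    then obtain r where "y = r\<^sup>2" by (auto simp: is_sq_def)
    then show ?thesis using assms x True is_sq_mult_square_iff[of r x] by (auto simp: mult.commute)
  qed (use x is_sq_mult_nonsquares in auto)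
qed

text \<open>Pigeonhole: the values of \<open>c * r\<^sup>2\<close> and those of
  \<open>m - d * s\<^sup>2\<close> form two sets of (q + 1)/2 elements each, which must
  meet.\<close>

lemma binary_form_universal:
  fixes c d m :: 'a
  assumes "c \<noteq> 0" "d \<noteq> 0"
  shows "\<exists>r s. c * r\<^sup>2 + d * s\<^sup>2 = m"
proof -
  let ?S = "{x::'a. is_sq x}"
  let ?A = "(\<lambda>x. c * x) ` ?S" and ?B = "(\<lambda>x. m - d * x) ` ?S"
  have "card ?A = card ?S" "card ?B = card ?S"
    using assms by (auto intro!: card_image inj_onI)
  moreover have "card (?A \<union> ?B) \<le> CARD('a)" by (simp add: card_mono)
  moreover have "card ?A + card ?B = card (?A \<union> ?B) + card (?A \<inter> ?B)"
    by (rule card_Un_Int) auto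
  ultimately have "card (?A \<inter> ?B) \<noteq> 0"
    using card_squares by linarith
  then obtain z where "z \<in> ?A" "z \<in> ?B" by (metis IntE card.empty equals0I)
  then obtain r s where "z = c * r\<^sup>2" "z = m - d * s\<^sup>2" unfolding is_sq_def by blast
  then have "c * r\<^sup>2 + d * s\<^sup>2 = m" by algebra
  then show ?thesis by blast
qed

end

section \<open>The quadratic extension\<close>

text \<open>
  The condition that \<open>n\<close> be a nonsquare makes the root \<open>\<epsilon>\<close> of \<open>X\<^sup>2 - t X + n\<close> a nonsquare of
  the extension, since \<open>n\<close> is its norm. It is dropped in characteristic two, where it cannot be met,
  in order that the extension is a field for every finite field.
\<close>

definition ext_coeffs :: "'a::{field,finite} \<times> 'a" where
  "ext_coeffs = (SOME (n, t). (\<forall>x. x\<^sup>2 - t * x + n \<noteq> 0) \<and> ((2::'a) \<noteq> 0 \<longrightarrow> \<not> is_sq n))"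

definition ext_norm :: "'a::{field,finite}" where "ext_norm = fst ext_coeffs"

definition ext_trace :: "'a::{field,finite}" where "ext_trace = snd ext_coeffs"

text \<open>In characteristic two, X^2 - X takes the same value at 0 and 1, so it misses some
  \<open>c\<close>. Otherwise a suitable trace has to be found for a given nonsquare norm.\<close>

lemma ex_ext_coeffs:
  "\<exists>n t :: 'a::{field,finite}. (\<forall>x. x\<^sup>2 - t * x + n \<noteq> 0) \<and> ((2::'a) \<noteq> 0 \<longrightarrow> \<not> is_sq n)"
proof (cases "(2::'a) = 0")
  case True
  have "\<not> inj (\<lambda>x::'a. x\<^sup>2 - x)"
  proof
    assume "inj (\<lambda>x::'a. x\<^sup>2 - x)"
    from injD[OF this, of 0 1] show False by simp
  qed
  then have "\<not> surj (\<lambda>x::'a. x\<^sup>2 - x)" using finite_UNIV_surj_inj[OF finite_class.finite_UNIV] by blast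
  then obtain c where c: "c \<noteq> x\<^sup>2 - x" for x :: 'a unfolding surj_def by blast
  have "\<forall>x::'a. x\<^sup>2 - 1 * x + (- c) \<noteq> 0"
  proof (intro allI notI)
    fix x assume "x\<^sup>2 - 1 * x + (- c) = 0"
    then have "c = x\<^sup>2 - x" by algebra
    then show False using c by blast
  qed
  then show ?thesis using True by blast
next
  case False
  then interpret odd_finite_field "TYPE('a)" by unfold_locales
  obtain n :: 'a where n: "\<not> is_sq n" using ex_nonsquare by blast
  then have n0: "n \<noteq> 0" by (auto simp: is_sq_def)
  \<comment> \<open>With trace \<open>2 * r\<close> the polynomial is (X - r)^2 - (r^2 - n). The
    choice makes r^2 - n equal to s^2 n, which is a nonsquare.\<close>
  obtain r s where rs: "1 * r\<^sup>2 + (- n) * s\<^sup>2 = n"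
    using binary_form_universal[of 1 "- n" n] n0 by auto
  then have "s \<noteq> 0" using n by (auto simp: is_sq_def)
  have "x\<^sup>2 - 2 * r * x + n \<noteq> 0" for x
  proof
    assume "x\<^sup>2 - 2 * r * x + n = 0"
    then have "s\<^sup>2 * n = (x - r)\<^sup>2" using rs by algebra
    then have "is_sq (s\<^sup>2 * n)" by (auto simp: is_sq_def)
    then show False using n is_sq_mult_square_iff[OF \<open>s \<noteq> 0\<close>] by blast
  qed
  then show ?thesis using n by blast
qed

lemma ext_coeffs:
  shows ext_irreducible: "\<And>x::'a::{field,finite}. x\<^sup>2 - ext_trace * x + ext_norm \<noteq> 0"
    and ext_norm_nonsquare: "(2::'a) \<noteq> 0 \<Longrightarrow> \<not> is_sq (ext_norm::'a)"
proof -
  have "\<exists>p. (case p of (n, t) \<Rightarrow> (\<forall>x::'a. x\<^sup>2 - t * x + n \<noteq> 0) \<and> ((2::'a) \<noteq> 0 \<longrightarrow> \<not> is_sq n))"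
    using ex_ext_coeffs by auto
  from someI_ex[OF this] show
    "\<And>x::'a::{field,finite}. x\<^sup>2 - ext_trace * x + ext_norm \<noteq> 0"
    "(2::'a) \<noteq> 0 \<Longrightarrow> \<not> is_sq (ext_norm::'a)"
    unfolding ext_norm_def ext_trace_def ext_coeffs_def by (auto simp: case_prod_unfold)
qed

section \<open>Field structure and norm of the quadratic extension\<close>

datatype 'a quad = Quad (re: 'a) (im: 'a)

lemma quad_eq_iff: "x = y \<longleftrightarrow> re x = re y \<and> im x = im y"
  by (cases x; cases y) auto

text \<open>\<open>Quad a b\<close> stands for a + b \<epsilon> with \<epsilon>^2 = t \<epsilon> -
  n. This is the field norm, the product with the conjugate a + t b - b \<epsilon>; the inverse
  below is the conjugate divided by it.\<close>

definition qnorm :: "'a::{field,finite} quad \<Rightarrow> 'a" where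
  "qnorm x = (re x)\<^sup>2 + ext_trace * re x * im x + ext_norm * (im x)\<^sup>2"

instantiation quad :: ("{field,finite}") field
begin

definition "0 = Quad 0 0"
definition "1 = Quad 1 0"
definition "x + y = Quad (re x + re y) (im x + im y)"
definition "- x = Quad (- re x) (- im x)"
definition "x - y = Quad (re x - re y) (im x - im y)"
definition "x * y = Quad (re x * re y - ext_norm * im x * im y)
  (re x * im y + im x * re y + ext_trace * im x * im y)"
definition "inverse x = Quad ((re x + ext_trace * im x) / qnorm x) (- im x / qnorm x)"
definition "x div (y::'a quad) = x * inverse y"

lemma quad_sel [simp]:
  "re 0 = 0" "im 0 = 0" "re 1 = 1" "im 1 = 0"
  "re (x + y) = re x + re y" "im (x + y) = im x + im y"
  "re (- x) = - re x" "im (- x) = - im x"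
  "re (x - y) = re x - re y" "im (x - y) = im x - im y"
  by (simp_all add: zero_quad_def one_quad_def plus_quad_def uminus_quad_def minus_quad_def)

lemma quad_sel_mult:
  "re (x * y) = re x * re y - ext_norm * im x * im y"
  "im (x * y) = re x * im y + im x * re y + ext_trace * im x * im y"
  by (simp_all add: times_quad_def)

text \<open>A zero of the norm with nonzero \<open>im x\<close> would make
  \<open>- re x / im x\<close> a root of the irreducible polynomial.\<close>

lemma qnorm_eq_0_iff [simp]: "qnorm x = 0 \<longleftrightarrow> x = 0"
proof
  assume 0: "qnorm x = 0"
  have "im x = 0"
  proof (rule ccontr)
    assume "im x \<noteq> 0"
    define z where "z = - re x / im x"
    have "re x = - z * im x" using \<open>im x \<noteq> 0\<close> by (simp add: z_def)
    then have "qnorm x = (im x)\<^sup>2 * (z\<^sup>2 - ext_trace * z + ext_norm)"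
      unfolding qnorm_def by algebra
    then show False using ext_irreducible[of z] 0 \<open>im x \<noteq> 0\<close> by simp
  qed
  then show "x = 0" using 0 by (simp add: qnorm_def quad_eq_iff)
qed (simp add: qnorm_def)

instance
proof
  fix a :: "'a quad"
  assume "a \<noteq> 0"
  then have "qnorm a \<noteq> 0" by simp
  moreover have "(re a + ext_trace * im a) * re a + ext_norm * im a * im a = qnorm a"
    by (simp add: qnorm_def algebra_simps power2_eq_square)
  ultimately have "(re a + ext_trace * im a) * re a / qnorm a + ext_norm * im a * im a / qnorm a = 1"
    by (simp flip: add_divide_distrib)
  then show "inverse a * a = 1"
    by (simp add: quad_eq_iff quad_sel_mult inverse_quad_def algebra_simps add_divide_distrib)
next
  show "inverse (0::'a quad) = 0" by (simp add: inverse_quad_def quad_eq_iff)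
qed (auto simp: quad_eq_iff quad_sel_mult divide_quad_def algebra_simps)

end

lemma quad_sel_two [simp]: "re 2 = 2" "im 2 = 0"
  unfolding one_add_one[symmetric] quad_sel by (rule refl) simp

lemma qnorm_mult: "qnorm (x * y) = qnorm x * qnorm y"
  unfolding qnorm_def quad_sel_mult by algebra

lemma UNIV_quad: "(UNIV :: 'a quad set) = (\<lambda>(a, b). Quad a b) ` UNIV"
  by (auto simp: image_def) (metis quad.exhaust)

instance quad :: (finite) finite
  by standard (simp add: UNIV_quad)

lemma card_quad: "CARD('a quad) = CARD('a)\<^sup>2"
proof -
  have "inj (\<lambda>(a::'a, b). Quad a b)" by (auto simp: inj_def)
  then show ?thesis by (simp add: UNIV_quad card_image power2_eq_square)
qed

definition emb :: "'a::{field,finite} \<Rightarrow> 'a quad" where "emb a = Quad a 0"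

definition eps :: "'a::{field,finite} quad" where "eps = Quad 0 1"

lemma emb_sel [simp]: "re (emb a) = a" "im (emb a) = 0"
  by (simp_all add: emb_def)

lemma eps_sel [simp]: "re eps = 0" "im eps = 1"
  by (simp_all add: eps_def)

lemma re_im_emb_mult [simp]: "re (emb a * x) = a * re x" "im (emb a * x) = a * im x"
  by (simp_all add: quad_sel_mult)

lemma emb_hom: "emb (a + b) = emb a + emb b" "emb (a * b) = emb a * emb b" "emb (- a) = - emb a"
  "emb (a - b) = emb a - emb b" "emb 0 = 0" "emb (a\<^sup>2) = (emb a)\<^sup>2"
  by (simp_all add: quad_eq_iff quad_sel_mult power2_eq_square)

lemma quad_re_zero: "re x = 0 \<Longrightarrow> x = eps * emb (im x)"
  by (simp add: quad_eq_iff quad_sel_mult)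

lemma qnorm_emb: "qnorm (emb a) = a\<^sup>2"
  by (simp add: qnorm_def)

lemma qnorm_eps: "qnorm eps = ext_norm"
  by (simp add: qnorm_def)

section \<open>Hemisystems from a conic over the quadratic extension\<close>

definition conic_form :: "'a::{field,finite} quad ^ 3 \<Rightarrow> 'a quad" where
  "conic_form x = (x $ 2)\<^sup>2 - x $ 1 * x $ 3"

definition conic_polar :: "'a::{field,finite} quad ^ 3 \<Rightarrow> 'a quad ^ 3 \<Rightarrow> 'a quad" where
  "conic_polar x y = 2 * x $ 2 * y $ 2 - x $ 1 * y $ 3 - x $ 3 * y $ 1"

text \<open>
  A nonzero zero of the conic form is \<open>u (r\<^sup>2, r s, s\<^sup>2)\<close>, where \<open>u\<close> is determined up to squares
  by either outer coordinate that is nonzero.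
\<close>

definition conic_coord :: "'a::{field,finite} quad ^ 3 \<Rightarrow> 'a quad" where
  "conic_coord x = (if x $ 1 \<noteq> 0 then x $ 1 else x $ 3)"

text \<open>Being a square of K is tested through the norm: in odd order an element of K is a square
  iff its norm is a square of the base field. Off the conic, a singular vector has form value
  \<epsilon> c with c in the base field, and \<open>im\<close> extracts c.\<close>

definition half_cone :: "('a::{field,finite} quad ^ 3) set" where
  "half_cone = {x. if conic_form x = 0 then is_sq (qnorm (conic_coord x)) else is_sq (im (conic_form x))}"

lemma conic_form_scale: "conic_form (k *s x) = k\<^sup>2 * conic_form x"
  by (simp add: conic_form_def power2_eq_square algebra_simps)

lemma conic_form_add: "conic_form (x + y) = conic_form x + conic_form y + conic_polar x y"
  by (simp add: conic_form_def conic_polar_def power2_eq_square algebra_simps)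

lemma conic_polar_commute: "conic_polar x y = conic_polar y x"
  by (simp add: conic_polar_def algebra_simps)

lemma conic_polar_linear:
  "conic_polar (x + x') y = conic_polar x y + conic_polar x' y"
  "conic_polar (k *s x) y = k * conic_polar x y"
  by (simp_all add: conic_polar_def algebra_simps)

lemma conic_polar_linear_right:
  "conic_polar x (y + y') = conic_polar x y + conic_polar x y'"
  "conic_polar x (k *s y) = k * conic_polar x y"
  by (simp_all add: conic_polar_def algebra_simps)

lemma conic_polar_self: "conic_polar x x = 2 * conic_form x"
  by (simp add: conic_form_def conic_polar_def power2_eq_square algebra_simps)

lemma vec3_eq_iff: "x = y \<longleftrightarrow> x $ 1 = y $ 1 \<and> x $ 2 = y $ 2 \<and> x $ 3 = y $ 3" for x y :: "'b ^ 3"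
  by (simp add: vec_eq_iff forall_3)

text \<open>On the tangent at a point \<open>y\<close> of the conic, the form is the square of a
  linear functional.\<close>

lemma conic_form_eq_square_on_tangent:
  assumes y: "conic_form y = 0" "y \<noteq> 0" and xy: "conic_polar x y = 0"
  shows "\<exists>w. conic_form x = w\<^sup>2"
proof (cases "y $ 1 = 0")
  case True
  then have 2: "y $ 2 = 0" using y by (simp add: conic_form_def)
  then have "y $ 3 \<noteq> 0" using y True by (auto simp: vec3_eq_iff)
  then have "x $ 1 = 0" using xy True 2 by (simp add: conic_polar_def)
  then show ?thesis by (auto simp: conic_form_def)
next
  case False
  have "(y $ 1)\<^sup>2 * conic_form x = (y $ 1 * x $ 2 - x $ 1 * y $ 2)\<^sup>2"
    using y(1) xy unfolding conic_form_def conic_polar_def by algebra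
  then have "conic_form x = ((y $ 1 * x $ 2 - x $ 1 * y $ 2) / y $ 1)\<^sup>2"
    using False by (simp add: power_divide nonzero_eq_divide_eq mult.commute)
  then show ?thesis by blast
qed

text \<open>A tangent meets the conic only in its point of contact, since the functional whose
  square is the form vanishes there alone.\<close>

lemma conic_zeros_proportional:
  assumes x: "conic_form x = 0" and y: "conic_form y = 0" "y \<noteq> 0" and xy: "conic_polar x y = 0"
  shows "\<exists>k. x = k *s y"
proof (cases "y $ 1 = 0")
  case True
  then have 2: "y $ 2 = 0" using y by (simp add: conic_form_def)
  then have 3: "y $ 3 \<noteq> 0" using y True by (auto simp: vec3_eq_iff)
  then have "x $ 1 = 0" using xy True 2 by (simp add: conic_polar_def)
  moreover from this have "x $ 2 = 0" using x by (simp add: conic_form_def)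
  ultimately have "x = (x $ 3 / y $ 3) *s y" using True 2 3 by (simp add: vec3_eq_iff)
  then show ?thesis by blast
next
  case False
  define k where "k = x $ 1 / y $ 1"
  have 1: "x $ 1 = k * y $ 1" using False by (simp add: k_def)
  have "(y $ 1 * x $ 2 - x $ 1 * y $ 2)\<^sup>2 = 0"
    using x y(1) xy unfolding conic_form_def conic_polar_def by algebra
  then have "y $ 1 * (x $ 2 - k * y $ 2) = 0" by (simp add: 1 algebra_simps)
  then have 2: "x $ 2 = k * y $ 2" using False by simp
  have "y $ 1 * (x $ 3 - k * y $ 3) = 0"
    using 1 2 xy y(1) unfolding conic_form_def conic_polar_def by algebra
  then have "x $ 3 = k * y $ 3" using False by simp
  then have "x = k *s y" using 1 2 by (simp add: vec3_eq_iff)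
  then show ?thesis by blast
qed

lemma conic_coord_neq_0:
  assumes "conic_form x = 0" "x \<noteq> 0"
  shows "conic_coord x \<noteq> 0"
  using assms by (auto simp: conic_coord_def conic_form_def vec3_eq_iff)

text \<open>For x = u (r^2, r s, s^2) and y = v (r'^2, r' s', s'^2) the polar form is - u v (r s' -
  s r')^2, and \<open>conic_coord\<close> gives u and v up to squares.\<close>

lemma conic_polar_coord:
  assumes x: "conic_form x = 0" and y: "conic_form y = 0"
  shows "\<exists>w. conic_polar x y * (conic_coord x * conic_coord y) = - (w\<^sup>2)"
proof -
  have "x $ 1 = 0 \<longrightarrow> x $ 2 = 0" "y $ 1 = 0 \<longrightarrow> y $ 2 = 0"
    using x y by (auto simp: conic_form_def)
  then consider "x $ 1 \<noteq> 0" "y $ 1 \<noteq> 0" | "x $ 1 = 0" "x $ 2 = 0" | "y $ 1 = 0" "y $ 2 = 0"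
    by blast
  then show ?thesis
  proof cases
    case 1
    have "conic_polar x y * (x $ 1 * y $ 1) = - ((x $ 1 * y $ 2 - x $ 2 * y $ 1)\<^sup>2)"
      using x y unfolding conic_form_def conic_polar_def by algebra
    then show ?thesis using 1 by (auto simp: conic_coord_def)
  next
    case 2
    show ?thesis
    proof (cases "y $ 1 = 0")
      case True
      then show ?thesis using 2 by (auto simp: conic_polar_def)
    next
      case False
      then have "conic_polar x y * (conic_coord x * conic_coord y) = - ((x $ 3 * y $ 1)\<^sup>2)"
        using 2 by (simp add: conic_polar_def conic_coord_def power2_eq_square)
      then show ?thesis by blast
    qed
  next
    case 3
    show ?thesis
    proof (cases "x $ 1 = 0")
      case True
      then show ?thesis using 3 by (auto simp: conic_polar_def)
    next
      case False
      then have "conic_polar x y * (conic_coord x * conic_coord y) = - ((y $ 3 * x $ 1)\<^sup>2)"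
        using 3 by (simp add: conic_polar_def conic_coord_def power2_eq_square)
      then show ?thesis by blast
    qed
  qed
qed

text \<open>Both values tested for squareness get multiplied by a^2, so membership depends only on
  the point over the base field.\<close>

lemma half_cone_scale:
  assumes "a \<noteq> 0"
  shows "emb a *s x \<in> half_cone \<longleftrightarrow> x \<in> half_cone"
proof -
  have a: "emb a \<noteq> 0" using assms by (metis emb_sel(1) quad_sel(1))
  then have "conic_coord (emb a *s x) = emb a * conic_coord x" by (simp add: conic_coord_def)
  then have "qnorm (conic_coord (emb a *s x)) = a\<^sup>2 * qnorm (conic_coord x)"
    by (simp add: qnorm_mult qnorm_emb)
  moreover have "im (conic_form (emb a *s x)) = a\<^sup>2 * im (conic_form x)"
    by (simp add: conic_form_scale flip: emb_hom)
  ultimately show ?thesis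
    using a is_sq_mult_square_iff[OF assms] by (simp add: half_cone_def conic_form_scale)
qed

context odd_finite_field
begin

text \<open>On the tangent the form value is a square of K, so its norm is a square. A nonzero value
  \<epsilon> c would have the nonsquare norm n c^2.\<close>

lemma tangent_zero:
  fixes x y :: "'a quad ^ 3"
  assumes y: "conic_form y = 0" "y \<noteq> 0" and xy: "conic_polar x y = 0" and x: "re (conic_form x) = 0"
  shows "conic_form x = 0"
proof (rule ccontr)
  assume nz: "conic_form x \<noteq> 0"
  define c where "c = im (conic_form x)"
  have c: "conic_form x = eps * emb c" using quad_re_zero[OF x] by (simp add: c_def)
  then have "c \<noteq> 0" using nz by (auto simp: emb_hom)
  obtain w where "conic_form x = w\<^sup>2" using conic_form_eq_square_on_tangent[OF y xy] by blast
  then have "qnorm (eps * emb c) = (qnorm w)\<^sup>2" using c by (simp add: power2_eq_square qnorm_mult)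
  then have "c\<^sup>2 * ext_norm = (qnorm w)\<^sup>2" by (simp add: qnorm_mult qnorm_emb qnorm_eps mult.commute)
  then have "is_sq (c\<^sup>2 * ext_norm)" by (auto simp: is_sq_def)
  then show False
    using is_sq_mult_square_iff[OF \<open>c \<noteq> 0\<close>] ext_norm_nonsquare two_neq_zero by blast
qed

text \<open>The polar value \<epsilon> h has nonsquare norm n h^2, but its product with both
  coordinates is minus a square and has square norm. Hence exactly one coordinate has square
  norm.\<close>

lemma half_cone_separates_conic_zeros:
  fixes x y :: "'a quad ^ 3"
  assumes x: "conic_form x = 0" "x \<noteq> 0" and y: "conic_form y = 0" "y \<noteq> 0"
    and xy: "re (conic_polar x y) = 0" "conic_polar x y \<noteq> 0"
  shows "x \<in> half_cone \<longleftrightarrow> y \<notin> half_cone"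
proof -
  let ?p = "qnorm (conic_coord x)" and ?q = "qnorm (conic_coord y)"
  have nz: "?p \<noteq> 0" "?q \<noteq> 0" using conic_coord_neq_0 x y by auto
  define h where "h = im (conic_polar x y)"
  have h: "conic_polar x y = eps * emb h" using quad_re_zero[OF xy(1)] by (simp add: h_def)
  then have "h \<noteq> 0" using xy(2) by (auto simp: emb_hom)
  obtain w where "conic_polar x y * (conic_coord x * conic_coord y) = - (w\<^sup>2)"
    using conic_polar_coord[OF x(1) y(1)] by blast
  then have "qnorm (conic_polar x y * (conic_coord x * conic_coord y)) = qnorm (- (w\<^sup>2))"
    by simp
  also have "qnorm (- (w\<^sup>2)) = (qnorm w)\<^sup>2"
    by (simp add: qnorm_def[of "- _"] flip: qnorm_def) (simp add: power2_eq_square qnorm_mult)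
  finally have "h\<^sup>2 * (ext_norm * (?p * ?q)) = (qnorm w)\<^sup>2"
    by (simp add: h qnorm_mult qnorm_emb qnorm_eps algebra_simps)
  then have "is_sq (h\<^sup>2 * (ext_norm * (?p * ?q)))" by (auto simp: is_sq_def)
  then have "is_sq (ext_norm * (?p * ?q))" using is_sq_mult_square_iff[OF \<open>h \<noteq> 0\<close>] by blast
  moreover have n: "\<not> is_sq (ext_norm :: 'a)" using ext_norm_nonsquare two_neq_zero by blast
  moreover from n have "(ext_norm :: 'a) \<noteq> 0" by (auto simp: is_sq_def)
  ultimately have "\<not> is_sq (?p * ?q)" using is_sq_mult_iff[of ext_norm "?p * ?q"] nz by auto
  then show ?thesis using is_sq_mult_iff[OF nz] x y by (simp add: half_cone_def)
qed

text \<open>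
  On a line on which the conic form vanishes identically, multiplication by the nonsquare \<open>\<epsilon>\<close>
  exchanges the two halves. On every other line the conic form is \<open>\<epsilon>\<close> times a nondegenerate binary
  form; a similarity of that form with nonsquare multiplier \<open>n\<close> and square \<open>n\<close> exchanges the
  values that are squares with those that are not, and fixes no zero.
\<close>

lemma half_cone_swap:
  fixes L :: "('a quad ^ 3) set"
  assumes add: "\<And>x y. x \<in> L \<Longrightarrow> y \<in> L \<Longrightarrow> x + y \<in> L"
    and scale: "\<And>a x. x \<in> L \<Longrightarrow> emb a *s x \<in> L"
    and card: "card L = CARD('a)\<^sup>2"
    and sing: "\<And>x. x \<in> L \<Longrightarrow> re (conic_form x) = 0"
  shows "\<exists>\<tau>. inj_on \<tau> (L - {0}) \<and> \<tau> ` (L - {0}) \<subseteq> L - {0} \<and>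
    (\<forall>x\<in>L - {0}. \<tau> x \<in> half_cone \<longleftrightarrow> x \<notin> half_cone)"
proof -
  have n: "\<not> is_sq (ext_norm :: 'a)" using ext_norm_nonsquare two_neq_zero by blast
  then have n0: "(ext_norm :: 'a) \<noteq> 0" by (auto simp: is_sq_def)
  have q: "card {0, 1::'a} \<le> CARD('a)" by (rule card_mono) auto
  have q2: "CARD('a) < CARD('a)\<^sup>2" using q by (simp add: power2_eq_square)
  have polar: "re (conic_polar x y) = 0" if "x \<in> L" "y \<in> L" for x y
    using sing[OF add[OF that]] sing[OF that(1)] sing[OF that(2)] by (simp add: conic_form_add)
  show ?thesis
  proof (cases "\<forall>x\<in>L. conic_form x = 0")
    case True
    have "\<not> L \<subseteq> {0}"
    proof
      assume "L \<subseteq> {0}"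
      then have "card L \<le> card {0::'a quad ^ 3}" by (rule card_mono[rotated]) simp
      then show False using card q q2 by simp
    qed
    then obtain y where y: "y \<in> L" "y \<noteq> 0" by blast
    have sub: "L \<subseteq> range (\<lambda>k. k *s y)"
    proof
      fix x assume x: "x \<in> L"
      have "conic_polar x y = 0"
        using True add[OF x y(1)] x y(1) conic_form_add[of x y] by simp
      then show "x \<in> range (\<lambda>k. k *s y)" using conic_zeros_proportional[of x y] True x y by blast
    qed
    \<comment> \<open>By cardinality, \<open>L\<close> is the whole K-line through \<open>y\<close>,
      hence closed under multiplication by \<epsilon>.\<close>
    have "card (range (\<lambda>k. k *s y)) \<le> card L"
      using card_image_le[of "UNIV :: 'a quad set" "\<lambda>k. k *s y"] card by (simp add: card_quad)
    then have L: "L = range (\<lambda>k. k *s y)" using sub by (intro card_seteq) auto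
    let ?t = "\<lambda>x :: 'a quad ^ 3. eps *s x"
    have eps0: "eps \<noteq> (0 :: 'a quad)" by (simp add: quad_eq_iff)
    have "inj_on ?t (L - {0})" using eps0 by (auto simp: inj_on_def)
    moreover have "?t ` (L - {0}) \<subseteq> L - {0}"
      using eps0 unfolding L by auto
    moreover have "?t x \<in> half_cone \<longleftrightarrow> x \<notin> half_cone" if "x \<in> L - {0}" for x
    proof -
      have x: "conic_form x = 0" "x \<noteq> 0" "conic_form (?t x) = 0"
        using True that by (auto simp: conic_form_scale)
      have "conic_coord (?t x) = eps * conic_coord x" using eps0 by (simp add: conic_coord_def)
      then have "qnorm (conic_coord (?t x)) = ext_norm * qnorm (conic_coord x)"
        by (simp add: qnorm_mult qnorm_eps)
      then show ?thesis
        using x is_sq_mult_iff[OF n0, of "qnorm (conic_coord x)"] n conic_coord_neq_0[OF x(1,2)]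
        by (simp add: half_cone_def)
    qed
    ultimately show ?thesis by blast
  next
    case False
    then obtain x where x: "x \<in> L" "conic_form x \<noteq> 0" by blast
    define c where "c = im (conic_form x)"
    have c: "conic_form x = eps * emb c" using quad_re_zero[OF sing[OF x(1)]] by (simp add: c_def)
    have c0: "c \<noteq> 0" using c x(2) by (auto simp: emb_hom)
    have "\<not> L \<subseteq> range (\<lambda>a. emb a *s x)"
    proof
      assume "L \<subseteq> range (\<lambda>a. emb a *s x)"
      then have "card L \<le> card (range (\<lambda>a. emb a *s x))" by (rule card_mono[rotated]) simp
      also have "\<dots> \<le> CARD('a)" by (rule card_image_le) simp
      finally show False using card q2 by simp
    qed
    then obtain z where z: "z \<in> L" "z \<notin> range (\<lambda>a. emb a *s x)" by blast
    define b where "b = im (conic_polar z x)"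
    have b: "conic_polar z x = eps * emb b"
      using quad_re_zero[OF polar[OF z(1) x(1)]] by (simp add: b_def)
    \<comment> \<open>Orthogonalization: the multiple of \<open>x\<close> removed from
      \<open>z\<close> is the one that makes \<open>y\<close> orthogonal to \<open>x\<close>, whose
      polar form with itself is 2 \<epsilon> c.\<close>
    define y where "y = z + emb (- (b / (2 * c))) *s x"
    have yL: "y \<in> L" unfolding y_def by (intro add scale z x)
    have "y \<noteq> 0"
    proof
      assume "y = 0"
      then have "z = emb (b / (2 * c)) *s x" by (simp add: y_def emb_hom)
      then show False using z(2) by blast
    qed
    have yx: "conic_polar y x = 0"
      using c0 two_neq_zero
      by (simp add: y_def conic_polar_linear conic_polar_self b c quad_eq_iff quad_sel_mult)
    define d where "d = im (conic_form y)"
    have d: "conic_form y = eps * emb d" using quad_re_zero[OF sing[OF yL]] by (simp add: d_def)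
    \<comment> \<open>Otherwise \<open>y\<close> is on the conic and \<open>x\<close> lies on its
      tangent, which forces \<open>conic_form x = 0\<close>.\<close>
    have "d \<noteq> 0"
    proof
      assume "d = 0"
      then have "conic_form y = 0" using d by (simp add: emb_hom)
      from tangent_zero[OF this \<open>y \<noteq> 0\<close>, of x] show False
        using x yx sing by (simp add: conic_polar_commute)
    qed
    define P where "P a b = emb a *s x + emb b *s y" for a b
    have polar_P: "conic_polar (P a b) (P a' b') = eps * emb (2 * c * a * a' + 2 * d * b * b')" for a b a' b'
      using yx conic_polar_commute[of x y]
      by (simp add: P_def conic_polar_linear conic_polar_linear_right conic_polar_self c d emb_hom algebra_simps)
        (simp add: quad_eq_iff quad_sel_mult algebra_simps)
    have form_P: "conic_form (P a b) = eps * emb (c * a\<^sup>2 + d * b\<^sup>2)" for a b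
      using yx conic_polar_commute[of x y]
      by (simp add: P_def conic_form_add conic_form_scale conic_polar_linear conic_polar_linear_right c d emb_hom algebra_simps)
    \<comment> \<open>Pairing with \<open>P 1 0\<close> and \<open>P 0 1\<close> isolates the two
      coordinates.\<close>
    have P_eq_0: "a = 0 \<and> b = 0" if "P a b = 0" for a b
    proof -
      have "2 * c * a * a' + 2 * d * b * b' = 0" for a' b'
      proof -
        have "conic_polar (P a b) (P a' b') = 0" using that by (simp add: conic_polar_def)
        then have "im (eps * emb (2 * c * a * a' + 2 * d * b * b')) = 0" by (simp only: polar_P quad_sel)
        then show ?thesis by (simp add: quad_sel_mult)
      qed
      from this[of 1 0] this[of 0 1] show ?thesis using c0 \<open>d \<noteq> 0\<close> two_neq_zero by simp
    qed
    have P_inj: "a = a' \<and> b = b'" if "P a b = P a' b'" for a b a' b'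
    proof -
      have "P (a - a') (b - b') = 0"
        using that by (simp add: P_def emb_hom vec.scale_left_diff_distrib algebra_simps)
      from P_eq_0[OF this] show ?thesis by simp
    qed
    have "card (range (\<lambda>(a, b). P a b)) = CARD('a)\<^sup>2"
      using P_inj by (subst card_image) (auto simp: inj_on_def power2_eq_square)
    moreover have "range (\<lambda>(a, b). P a b) \<subseteq> L"
      by (auto simp: P_def intro!: add scale x yL)
    ultimately have L: "range (\<lambda>(a, b). P a b) = L" using card by (intro card_subset_eq) auto
    obtain r s where rs: "c * r\<^sup>2 + d * s\<^sup>2 = ext_norm * c"
      using binary_form_universal[OF c0 \<open>d \<noteq> 0\<close>] by blast
    define e where "e = d / c"
    have ec: "e * c = d" using c0 by (simp add: e_def)
    have rs': "r\<^sup>2 + e * s\<^sup>2 = ext_norm"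
    proof -
      have "c * (r\<^sup>2 + e * s\<^sup>2) = c * ext_norm" using rs ec by algebra
      then show ?thesis using c0 by simp
    qed
    \<comment> \<open>The similarity: \<open>x\<close> of value c goes to r x + s y of value n c,
      and \<open>y\<close> goes to e s x - r y, which is orthogonal to that image and has value n
      d.\<close>
    define T where "T a b = P (r * a + e * s * b) (s * a - r * b)" for a b
    have T_inj: "a = a' \<and> b = b'" if "T a b = T a' b'" for a b a' b'
    proof -
      from P_inj[OF that[unfolded T_def]]
      have "r * (a - a') + e * s * (b - b') = 0" "s * (a - a') - r * (b - b') = 0"
        by (auto simp: algebra_simps)
      \<comment> \<open>Applying the matrix of \<open>T\<close> twice multiplies by n, so it is
        invertible.\<close>
      then have "ext_norm * (a - a') = 0" "ext_norm * (b - b') = 0" using rs' by algebra+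
      then show ?thesis using n0 by simp
    qed
    have P0: "P 0 0 = 0" by (simp add: P_def emb_hom)
    have T0: "T 0 0 = 0" by (simp add: T_def P0)
    define g where "g v = (SOME p. v = (\<lambda>(a, b). P a b) p)" for v
    have g: "v = (\<lambda>(a, b). P a b) (g v)" if "v \<in> L" for v
      unfolding g_def using that by (rule_tac someI_ex) (auto simp flip: L)
    have gP: "g (P a b) = (a, b)" for a b
    proof -
      have "P a b \<in> L" unfolding L[symmetric] by auto
      from g[OF this] show ?thesis using P_inj by (cases "g (P a b)") auto
    qed
    let ?t = "\<lambda>v. (\<lambda>(a, b). T a b) (g v)"
    have tP: "?t (P a b) = T a b" for a b by (simp add: gP)
    have "inj_on ?t (L - {0})"
    proof (rule inj_onI)
      fix v w assume v: "v \<in> L - {0}" and w: "w \<in> L - {0}" and eq: "?t v = ?t w"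
      obtain a b where "v = P a b" using v L by auto
      moreover obtain a' b' where "w = P a' b'" using w L by auto
      ultimately show "v = w" using eq T_inj[of a b a' b'] by (simp add: gP)
    qed
    moreover have "?t ` (L - {0}) \<subseteq> L - {0}"
    proof
      fix w assume "w \<in> ?t ` (L - {0})"
      then obtain v where v: "v \<in> L - {0}" "w = ?t v" by blast
      obtain a b where ab: "v = P a b" using v L by auto
      have w: "w = T a b" using v(2) ab by (simp add: gP)
      have "w \<noteq> 0" using T_inj[of a b 0 0] v(1) ab P0 T0 w by auto
      moreover have "w \<in> L" unfolding w T_def L[symmetric] by auto
      ultimately show "w \<in> L - {0}" by simp
    qed
    moreover have "?t v \<in> half_cone \<longleftrightarrow> v \<notin> half_cone" if v: "v \<in> L - {0}" for v
    proof -
      obtain a b where ab: "v = P a b" using v L by auto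
      have tv: "?t v = T a b" using ab by (simp add: gP)
      have nz: "v \<noteq> 0" "T a b \<noteq> 0" using T_inj[of a b 0 0] v ab P0 T0 by auto
      define G where "G = c * a\<^sup>2 + d * b\<^sup>2"
      have fv: "conic_form v = eps * emb G" by (simp add: ab form_P G_def)
      have "c * (r * a + e * s * b)\<^sup>2 + d * (s * a - r * b)\<^sup>2 = ext_norm * G"
        unfolding G_def ec[symmetric] rs'[symmetric] by algebra
      then have fT: "conic_form (T a b) = eps * emb (ext_norm * G)" by (simp add: T_def form_P)
      show ?thesis
      proof (cases "G = 0")
        case False
        then show ?thesis
          using is_sq_mult_iff[OF n0 False] n n0
          by (simp add: tv half_cone_def fv fT quad_eq_iff quad_sel_mult)
      next
        case True
        have z: "conic_form v = 0" "conic_form (T a b) = 0"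
          using True fv fT by (simp_all add: emb_hom)
        have "a \<noteq> 0"
        proof
          assume "a = 0"
          then have "b = 0" using True \<open>d \<noteq> 0\<close> by (simp add: G_def)
          then show False using \<open>a = 0\<close> nz(1) ab P0 by simp
        qed
        \<comment> \<open>Here \<open>v\<close> and its image are both on the conic; they lie in
          different halves once their polar value is known to be nonzero.\<close>
        define h where "h = 2 * c * a * (r * a + e * s * b) + 2 * d * b * (s * a - r * b)"
        have h: "conic_polar v (T a b) = eps * emb h" by (simp add: ab T_def polar_P h_def)
        have "h \<noteq> 0"
        proof
          assume "h = 0"
          \<comment> \<open>By d b^2 = - c a^2 both summands of \<open>h\<close> are equal.\<close>
          then have "2 * (2 * a * c * (r * a + e * s * b)) = 0"
            using True ec unfolding h_def G_def by algebra
          then have "r * a + e * s * b = 0"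
            using c0 \<open>a \<noteq> 0\<close> two_neq_zero by (simp only: mult_eq_0_iff) simp
          then have "c * a\<^sup>2 * ext_norm = 0"
            using True unfolding G_def ec[symmetric] rs'[symmetric] by algebra
          then show False using c0 \<open>a \<noteq> 0\<close> n0 by simp
        qed
        then have "conic_polar v (T a b) \<noteq> 0" "re (conic_polar v (T a b)) = 0"
          by (simp_all add: h quad_eq_iff quad_sel_mult)
        from half_cone_separates_conic_zeros[OF z(1) nz(1) z(2) nz(2) this(2,1)]
        show ?thesis by (simp add: tv)
      qed
    qed
    ultimately show ?thesis by blast
  qed
qed

end

section \<open>Quadratic spaces\<close>

text \<open>Induction over a basis: a vector of the span of \<open>insert b B\<close> is uniquely a
  multiple of \<open>b\<close> plus a vector of the span of \<open>B\<close>.\<close>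

lemma card_subspace:
  fixes S :: "('a::{field,finite} ^ 'n) set"
  assumes "vec.subspace S"
  shows "card S = CARD('a) ^ vec.dim S"
proof -
  have "card (vec.span B) = CARD('a) ^ card B" if "finite B" "vec.independent B" for B :: "('a ^ 'n) set"
    using that
  proof (induction B rule: finite_induct)
    case empty
    then show ?case by simp
  next
    case (insert b B)
    have b: "b \<notin> vec.span B" using insert.prems insert.hyps by (auto simp: vec.independent_insert)
    let ?f = "\<lambda>(k, v). k *s b + v"
    have "inj_on ?f (UNIV \<times> vec.span B)"
    proof (rule inj_onI, clarify)
      fix k v l w
      assume v: "v \<in> vec.span B" and w: "w \<in> vec.span B" and eq: "k *s b + v = l *s b + w"
      have "(k - l) *s b = w - v" using eq by (simp add: vec.scale_left_diff_distrib algebra_simps)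
      then have "(k - l) *s b \<in> vec.span B" using v w vec.span_diff by simp
      have "k = l"
      proof (rule ccontr)
        assume "k \<noteq> l"
        then have "b = (1 / (k - l)) *s ((k - l) *s b)" by (simp only: vec.scale_scale) simp
        then show False using b vec.span_scale[OF \<open>(k - l) *s b \<in> vec.span B\<close>] by metis
      qed
      then show "k = l \<and> v = w" using eq by simp
    qed
    moreover have "?f ` (UNIV \<times> vec.span B) = vec.span (insert b B)"
    proof
      show "?f ` (UNIV \<times> vec.span B) \<subseteq> vec.span (insert b B)"
        by (auto intro!: vec.span_add vec.span_scale vec.span_base[of b] intro: vec.span_mono[THEN subsetD, of B])
      show "vec.span (insert b B) \<subseteq> ?f ` (UNIV \<times> vec.span B)"
        by (force simp: vec.span_breakdown_eq image_iff)
    qed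
    ultimately have "card (vec.span (insert b B)) = card ((UNIV :: 'a set) \<times> vec.span B)"
      by (metis card_image)
    then show ?case using insert by (auto simp: card_cartesian_product vec.independent_insert)
  qed
  moreover obtain B where B: "B \<subseteq> S" "vec.independent B" "S \<subseteq> vec.span B" "card B = vec.dim S"
    using vec.basis_exists by blast
  moreover have "vec.span B = S" using B assms vec.span_minimal by blast
  ultimately show ?thesis using vec.finiteI_independent by metis
qed

locale quadratic_space =
  fixes Q :: "'a::{field,finite} ^ 'n \<Rightarrow> 'a"
  assumes quadratic_form: "quadratic_form Q"
begin

abbreviation B where "B \<equiv> polar_form Q"

lemma Q_scale: "Q (c *s x) = c\<^sup>2 * Q x"
  using quadratic_form by (simp add: quadratic_form_def)

lemma B_commute: "B x y = B y x"
  by (simp add: polar_form_def add.commute)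

lemma B_add: "B (x + y) z = B x z + B y z" "B z (x + y) = B z x + B z y"
  using quadratic_form B_commute by (simp_all add: quadratic_form_def)

lemma B_scale: "B (c *s x) z = c * B x z" "B z (c *s x) = c * B z x"
  using quadratic_form B_commute by (simp_all add: quadratic_form_def)

lemma B_0 [simp]: "B 0 z = 0" "B z 0 = 0"
  using B_scale(1)[of 0 0 z] B_scale(2)[of z 0 0] by simp_all

lemma B_minus: "B (- x) z = - B x z" "B z (- x) = - B z x"
  using B_add[of x "- x" z] B_add[of z x "- x"] by (simp_all add: eq_neg_iff_add_eq_0 add.commute)

lemma B_diff: "B (x - y) z = B x z - B y z" "B z (x - y) = B z x - B z y"
  using B_add(1)[of x "- y"] B_add(2)[of z x "- y"] by (simp_all add: B_minus)

lemma B_sum: "B (sum f A) z = (\<Sum>i\<in>A. B (f i) z)" "B z (sum f A) = (\<Sum>i\<in>A. B z (f i))"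
  by (induction A rule: infinite_finite_induct) (simp_all add: B_add)

lemma Q_0 [simp]: "Q 0 = 0"
  using Q_scale[of 0 0] by simp

lemma Q_add: "Q (x + y) = Q x + Q y + B x y"
  by (simp add: polar_form_def)

lemma B_self: "B x x = 2 * Q x"
proof -
  have "x + x = 2 *s x" by (simp add: vec_eq_iff)
  then show ?thesis by (simp add: polar_form_def Q_scale)
qed

section \<open>Totally singular subspaces and the Witt index\<close>

lemma totally_singular_B:
  assumes "totally_singular Q U" "u \<in> U" "v \<in> U"
  shows "B u v = 0"
  using assms by (simp add: totally_singular_def polar_form_def vec.subspace_add)

lemma totally_singular_span_insert:
  assumes U: "totally_singular Q U" and v: "Q v = 0" "\<And>u. u \<in> U \<Longrightarrow> B u v = 0"
  shows "totally_singular Q (vec.span (insert v U))"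
  unfolding totally_singular_def
proof (intro conjI ballI)
  fix w assume "w \<in> vec.span (insert v U)"
  moreover have "vec.span U = U" using U by (simp add: totally_singular_def vec.span_eq_iff)
  ultimately obtain k where k: "w - k *s v \<in> U" by (auto simp: vec.span_breakdown_eq)
  have "Q w = Q ((w - k *s v) + k *s v)" by simp
  also have "\<dots> = 0"
    unfolding Q_add using U k v by (simp add: Q_scale B_scale totally_singular_def)
  finally show "Q w = 0" .
qed simp

text \<open>Each linear condition lowers the dimension by at most one.\<close>

lemma dim_orthogonal_le:
  assumes "vec.subspace U" "finite S"
  shows "vec.dim U \<le> vec.dim {u \<in> U. \<forall>s\<in>S. B s u = 0} + card S"
  using assms(2)
proof (induction S rule: finite_induct)
  case empty
  then show ?case by simp
next
  case (insert s S)
  let ?V = "{u \<in> U. \<forall>s\<in>S. B s u = 0}" and ?W = "{u \<in> U. \<forall>s\<in>insert s S. B s u = 0}"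
  have "vec.dim ?V \<le> vec.dim ?W + 1"
  proof (cases "\<forall>v\<in>?V. B s v = 0")
    case True
    then have "?W = ?V" by auto
    then show ?thesis by simp
  next
    case False
    then obtain g where g: "g \<in> ?V" "B s g \<noteq> 0" by blast
    have "?V \<subseteq> vec.span (insert g ?W)"
    proof
      fix v assume v: "v \<in> ?V"
      have "v - (B s v / B s g) *s g \<in> ?W"
      proof (intro CollectI conjI ballI)
        show "v - (B s v / B s g) *s g \<in> U"
          using v g assms(1) by (intro vec.subspace_diff vec.subspace_scale) auto
        show "B s' (v - (B s v / B s g) *s g) = 0" if "s' \<in> insert s S" for s'
          using that v g by (cases "s' = s") (simp_all add: B_diff B_scale)
      qed
      then show "v \<in> vec.span (insert g ?W)"
        unfolding vec.span_breakdown_eq by (intro exI) (rule vec.span_base)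
    qed
    then have "vec.dim ?V \<le> vec.dim (insert g ?W)" by (rule vec.dim_mono)
    also have "\<dots> \<le> vec.dim ?W + 1" by (simp add: vec.dim_insert)
    finally show ?thesis .
  qed
  then show ?case using insert by simp
qed

text \<open>Vectors of \<open>U\<close> are already orthogonal to the intersection of
  \<open>U\<close> and \<open>M\<close>. Only dim M - dim (U \<inter> M) conditions remain, so the
  solutions in \<open>U\<close> have dimension greater than dim (U \<inter> M) and are not all in
  \<open>M\<close>.\<close>

lemma totally_singular_exchange:
  assumes U: "totally_singular Q U" and M: "totally_singular Q M" and dim: "vec.dim M < vec.dim U"
  shows "\<exists>v\<in>U. v \<notin> M \<and> (\<forall>m\<in>M. B m v = 0)"
proof -
  have sub: "vec.subspace U" "vec.subspace M" "vec.subspace (U \<inter> M)"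
    using U M by (auto simp: totally_singular_def vec.subspace_inter)
  obtain B0 where B0: "B0 \<subseteq> U \<inter> M" "vec.independent B0" "U \<inter> M \<subseteq> vec.span B0" "card B0 = vec.dim (U \<inter> M)"
    using vec.basis_exists by blast
  obtain B1 where B1: "B0 \<subseteq> B1" "B1 \<subseteq> M" "vec.independent B1" "M \<subseteq> vec.span B1"
    using vec.maximal_independent_subset_extend[of B0 M] B0 by blast
  have fin: "finite B1" "finite B0" using B0 B1 by (auto simp: vec.finiteI_independent)
  have cB1: "card B1 = vec.dim M" using vec.dim_unique[OF B1(2,4,3)] by simp
  let ?W = "{u \<in> U. \<forall>s\<in>B1 - B0. B s u = 0}"
  have "vec.dim U \<le> vec.dim ?W + card (B1 - B0)"
    using dim_orthogonal_le[OF sub(1)] fin by blast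
  moreover have "card (B1 - B0) = vec.dim M - vec.dim (U \<inter> M)"
    using card_Diff_subset[OF fin(2) B1(1)] cB1 B0(4) by simp
  moreover have "vec.dim (U \<inter> M) \<le> vec.dim M" by (simp add: vec.dim_subset)
  ultimately have "vec.dim (U \<inter> M) < vec.dim ?W" using dim by linarith
  then have "\<not> ?W \<subseteq> U \<inter> M" using vec.dim_subset[of ?W "U \<inter> M"] by linarith
  then obtain v where v: "v \<in> ?W" "v \<notin> U \<inter> M" by blast
  have "M \<subseteq> {m. B m v = 0}"
  proof -
    have "vec.span B1 \<subseteq> {m. B m v = 0}"
    proof (rule vec.span_minimal)
      show "B1 \<subseteq> {m. B m v = 0}"
        using v B0(1) totally_singular_B[OF U] by blast
      show "vec.subspace {m. B m v = 0}"
        by (auto simp: vec.subspace_def B_add B_scale)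
    qed
    then show ?thesis using B1(4) by blast
  qed
  then show ?thesis using v by blast
qed

lemma generator_extend:
  assumes G: "G \<in> generators Q W" and W: "vec.subspace W"
    and v: "v \<in> W" "Q v = 0" "\<And>g. g \<in> G \<Longrightarrow> B g v = 0"
  shows "v \<in> G"
proof -
  have ts: "totally_singular Q G" and "G \<subseteq> W" using G by (auto simp: generators_def)
  have "G \<subseteq> vec.span (insert v G)" by (auto intro: vec.span_base)
  moreover have "vec.span (insert v G) \<subseteq> W"
    using W v \<open>G \<subseteq> W\<close> by (intro vec.span_minimal) auto
  moreover have "totally_singular Q (vec.span (insert v G))"
    using totally_singular_span_insert[OF ts v(2,3)] .
  ultimately have "vec.span (insert v G) = G" using G by (auto simp: generators_def)
  then show ?thesis using vec.span_base[of v "insert v G"] by simp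
qed

text \<open>A larger totally singular subspace would supply, by exchange, a singular vector
  extending \<open>G\<close>. All generators thus have the same dimension, the Witt index.\<close>

lemma dim_le_generator:
  assumes G: "G \<in> generators Q W" and W: "vec.subspace W"
    and U: "totally_singular Q U" "U \<subseteq> W"
  shows "vec.dim U \<le> vec.dim G"
proof (rule ccontr)
  assume "\<not> ?thesis"
  then have "vec.dim G < vec.dim U" by simp
  moreover have "totally_singular Q G" using G by (simp add: generators_def)
  ultimately obtain v where v: "v \<in> U" "v \<notin> G" "\<forall>g\<in>G. B g v = 0"
    using totally_singular_exchange U(1) by blast
  moreover have "v \<in> W" "Q v = 0" using v U by (auto simp: totally_singular_def)
  ultimately show False using generator_extend[OF G W] by blast
qed

lemma witt_index_eq_dim_generator:
  assumes G: "G \<in> generators Q W" and W: "vec.subspace W"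
  shows "witt_index Q W = vec.dim G"
  unfolding witt_index_def
proof (rule Max_eqI)
  show "finite {vec.dim U |U. U \<subseteq> W \<and> totally_singular Q U}" by simp
  show "y \<le> vec.dim G" if "y \<in> {vec.dim U |U. U \<subseteq> W \<and> totally_singular Q U}" for y
    using that dim_le_generator[OF G W] by blast
  show "vec.dim G \<in> {vec.dim U |U. U \<subseteq> W \<and> totally_singular Q U}"
    using G by (auto simp: generators_def)
qed

lemma dim_le_witt_index:
  assumes "totally_singular Q U" "U \<subseteq> W"
  shows "vec.dim U \<le> witt_index Q W"
  unfolding witt_index_def using assms by (intro Max_ge) auto

lemma generatorI:
  assumes G: "totally_singular Q G" "G \<subseteq> W" and dim: "witt_index Q W \<le> vec.dim G"
  shows "G \<in> generators Q W"
proof -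
  have "U = G" if "G \<subseteq> U" "U \<subseteq> W" "totally_singular Q U" for U
    using vec.subspace_dim_equal[of G U] that G dim dim_le_witt_index[of U W]
    by (simp add: totally_singular_def)
  then show ?thesis using G by (auto simp: generators_def)
qed

lemma ex_totally_singular_dim_witt_index:
  assumes "vec.subspace W"
  shows "\<exists>M. totally_singular Q M \<and> M \<subseteq> W \<and> vec.dim M = witt_index Q W"
proof -
  have "totally_singular Q {0}" by (auto simp: totally_singular_def)
  moreover have "{0} \<subseteq> W" using assms by (simp add: vec.subspace_0)
  ultimately have "{vec.dim U |U. U \<subseteq> W \<and> totally_singular Q U} \<noteq> {}" by blast
  then have "witt_index Q W \<in> {vec.dim U |U. U \<subseteq> W \<and> totally_singular Q U}"
    unfolding witt_index_def by (intro Max_in) auto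
  then show ?thesis by auto
qed

section \<open>Nondegeneracy and hyperbolic pairs\<close>

text \<open>Induction on \<open>E\<close>: if \<open>e\<close> imposes a new condition, a vector
  \<open>g\<close> orthogonal to \<open>E\<close> but not to \<open>e\<close> gives the multiple of
  \<open>e\<close> to subtract from \<open>x\<close>.\<close>

lemma orthogonal_complement_twice:
  assumes nondeg: "\<And>x. \<forall>v. B x v = 0 \<Longrightarrow> x = 0"
    and "finite E" and "\<And>v. (\<forall>e\<in>E. B e v = 0) \<Longrightarrow> B x v = 0"
  shows "x \<in> vec.span E"
  using assms(2,3)
proof (induction E arbitrary: x rule: finite_induct)
  case empty
  then have "x = 0" using nondeg by auto
  then show ?case by simp
next
  case (insert e E)
  show ?case
  proof (cases "\<forall>v. (\<forall>e\<in>E. B e v = 0) \<longrightarrow> B e v = 0")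
    case True
    then have "x \<in> vec.span E" using insert.IH insert.prems by blast
    then show ?thesis using vec.span_mono[of E "insert e E"] by blast
  next
    case False
    then obtain g where g: "\<forall>e\<in>E. B e g = 0" "B e g \<noteq> 0" by blast
    have "x - (B x g / B e g) *s e \<in> vec.span E"
    proof (rule insert.IH)
      fix v assume v: "\<forall>e\<in>E. B e v = 0"
      have "B x (v - (B e v / B e g) *s g) = 0"
        using g v by (intro insert.prems) (auto simp: B_diff B_scale)
      then show "B (x - (B x g / B e g) *s e) v = 0"
        by (simp add: B_diff B_scale mult.commute)
    qed
    then show ?thesis by (auto simp: vec.span_breakdown_eq)
  qed
qed

lemma Q_nondegenerate:
  assumes "(2::'a) \<noteq> 0" "nonsingular_on Q UNIV" "\<forall>v. B x v = 0"
  shows "x = 0"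
proof -
  have "Q x = 0" using assms(1,3) B_self[of x] by simp
  then show ?thesis using assms by (auto simp: nonsingular_on_def)
qed

lemma ex_hyperbolic_pairs:
  fixes e :: "'i::finite \<Rightarrow> 'a ^ 'n"
  assumes two: "(2::'a) \<noteq> 0" and ns: "nonsingular_on Q UNIV"
    and e: "inj e" "vec.independent (range e)" "totally_singular Q (vec.span (range e))"
  shows "\<exists>f. (\<forall>i j. B (e i) (f j) = (if i = j then 1 else 0)) \<and>
    (\<forall>i j. B (e i) (e j) = 0) \<and> (\<forall>i j. B (f i) (f j) = 0)"
proof -
  have ee: "B (e i) (e j) = 0" for i j
    by (intro totally_singular_B[OF e(3)] vec.span_base) auto
  have "\<exists>g. \<forall>i. B (e i) g = (if i = j then 1 else 0)" for j
  proof -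
    \<comment> \<open>By the double complement, independence yields a vector orthogonal to all the
      other \<open>e i\<close> but not to \<open>e j\<close>.\<close>
    have "e j \<notin> vec.span (e ` (- {j}))"
    proof -
      have "e ` (- {j}) = range e - {e j}" using e(1) by (auto simp: inj_def)
      then show ?thesis using e(2) by (auto simp: vec.dependent_def)
    qed
    then obtain v where v: "\<forall>i\<in>- {j}. B (e i) v = 0" "B (e j) v \<noteq> 0"
      using orthogonal_complement_twice[of "e ` (- {j})" "e j"] Q_nondegenerate[OF two ns] by auto
    then have "\<forall>i. B (e i) ((1 / B (e j) v) *s v) = (if i = j then 1 else 0)"
      by (auto simp: B_scale)
    then show ?thesis by blast
  qed
  then obtain g where g: "\<And>i j. B (e i) (g j) = (if i = j then 1 else 0)" by metis
  \<comment> \<open>Subtracting half of the Gram matrix of \<open>g\<close> keeps the duality with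
    \<open>e\<close>; the two corrections together cancel \<open>B (g i) (g j)\<close>.\<close>
  define f where "f j = g j - (\<Sum>i\<in>UNIV. (B (g i) (g j) / 2) *s e i)" for j
  have ef: "B (e i) (f j) = (if i = j then 1 else 0)" for i j
    by (simp add: f_def B_diff B_sum B_scale ee g)
  have gf: "B (g i) (f j) = B (g i) (g j) / 2" for i j
  proof -
    have "B (g i) (f j) = B (g i) (g j) - (\<Sum>k\<in>UNIV. B (g k) (g j) / 2 * (if k = i then 1 else 0))"
      by (simp add: f_def B_diff B_sum B_scale B_commute[of "g i" "e _"] g)
    also have "\<dots> = B (g i) (g j) - B (g i) (g j) / 2" by (simp only: mult_delta_right) simp
    also have "\<dots> = B (g i) (g j) / 2" using two by (simp add: field_simps)
    finally show ?thesis .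
  qed
  have ff: "B (f i) (f j) = 0" for i j
  proof -
    have "B (f i) (f j) = B (g i) (f j) - (\<Sum>k\<in>UNIV. (B (g k) (g i) / 2) * B (e k) (f j))"
      by (simp add: f_def[of i] B_diff B_sum B_scale)
    also have "\<dots> = B (g i) (g j) / 2 - B (g j) (g i) / 2" by (simp only: gf ef mult_delta_right) simp
    also have "\<dots> = 0" by (simp add: B_commute)
    finally show ?thesis .
  qed
  then show ?thesis using ef ee by blast
qed

end

section \<open>From sets of vectors to ovoids\<close>

lemma proj_point_eq_span:
  assumes "P \<in> proj_points W" "v \<in> P" "v \<noteq> 0"
  shows "P = vec.span {v}"
proof -
  have P: "vec.subspace P" "vec.dim P = 1" using assms(1) by (auto simp: proj_points_def)
  have "vec.span {v} \<subseteq> P" using assms(2) P(1) by (intro vec.span_minimal) auto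
  moreover have "vec.dim (vec.span {v}) = 1"
    using assms(3) by (subst vec.dim_span_eq_card_independent) (auto simp: vec.independent_insert)
  ultimately show ?thesis using vec.subspace_dim_equal[of "vec.span {v}" P] P by simp
qed

lemma proj_points_ex_nonzero:
  assumes "P \<in> proj_points W"
  shows "\<exists>v\<in>P. v \<noteq> 0"
proof (rule ccontr)
  assume "\<not> ?thesis"
  then have "P \<subseteq> {0}" by blast
  then have "vec.dim P = 0" by simp
  then show False using assms by (simp add: proj_points_def del: vec.dim_eq_0)
qed

definition cone_points :: "('a::field ^ 'n \<Rightarrow> 'a) \<Rightarrow> ('a ^ 'n) set \<Rightarrow> ('a ^ 'n) set \<Rightarrow> ('a ^ 'n) set set" where
  "cone_points Q W C = {P \<in> quadric Q W. P - {0} \<subseteq> C}"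

context quadratic_space
begin

lemma span_singleton_in_quadric:
  assumes "vec.subspace W" "v \<in> W" "v \<noteq> 0" "Q v = 0"
  shows "vec.span {v} \<in> quadric Q W"
proof -
  have "vec.dim (vec.span {v}) = 1"
    using assms(3) by (subst vec.dim_span_eq_card_independent) (auto simp: vec.independent_insert)
  moreover have "vec.span {v} \<subseteq> W" using assms by (intro vec.span_minimal) auto
  moreover have "\<forall>w\<in>vec.span {v}. Q w = 0" using assms(4) by (auto simp: vec.span_singleton Q_scale)
  ultimately show ?thesis by (auto simp: quadric_def proj_points_def)
qed

text \<open>The exchange map embeds each half of the nonzero vectors of a generator in the other, so
  \<open>C\<close> contains (q^2 - 1)/2 of them. A point has q - 1 nonzero vectors, which leaves (q
  + 1)/2 points.\<close>

lemma is_ovoid_cone_points: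
  assumes W: "vec.subspace W" and gen: "\<And>G. G \<in> generators Q W \<Longrightarrow> vec.dim G = 2"
    and scale: "\<And>c v. c \<noteq> 0 \<Longrightarrow> v \<in> C \<Longrightarrow> c *s v \<in> C"
    and swap: "\<And>L. totally_singular Q L \<Longrightarrow> L \<subseteq> W \<Longrightarrow> vec.dim L = 2 \<Longrightarrow>
      \<exists>\<tau>. inj_on \<tau> (L - {0}) \<and> \<tau> ` (L - {0}) \<subseteq> L - {0} \<and> (\<forall>v\<in>L - {0}. \<tau> v \<in> C \<longleftrightarrow> v \<notin> C)"
  shows "is_ovoid ((CARD('a) + 1) div 2) Q W (cone_points Q W C)"
  unfolding is_ovoid_def
proof (intro conjI ballI)
  show "cone_points Q W C \<subseteq> quadric Q W" by (auto simp: cone_points_def)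
next
  fix G assume G: "G \<in> generators Q W"
  then have ts: "totally_singular Q G" and GW: "G \<subseteq> W" by (auto simp: generators_def)
  then have Gsub: "vec.subspace G" by (simp add: totally_singular_def)
  let ?q = "CARD('a)"
  have q: "?q \<ge> 2" using card_mono[of "UNIV :: 'a set" "{0, 1}"] by simp
  obtain \<tau> where \<tau>: "inj_on \<tau> (G - {0})" "\<tau> ` (G - {0}) \<subseteq> G - {0}" "\<forall>v\<in>G - {0}. \<tau> v \<in> C \<longleftrightarrow> v \<notin> C"
    using swap[OF ts GW gen[OF G]] by (elim exE conjE) (rule that)
  define A where "A = (G - {0}) \<inter> C"
  define A' where "A' = (G - {0}) - C"
  have "card A \<le> card A'"
  proof (rule card_inj_on_le)
    show "inj_on \<tau> A" using \<tau>(1) by (rule inj_on_subset) (auto simp: A_def)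
    show "\<tau> ` A \<subseteq> A'" using \<tau>(2,3) unfolding A_def A'_def by blast
  qed simp
  moreover have "card A' \<le> card A"
  proof (rule card_inj_on_le)
    show "inj_on \<tau> A'" using \<tau>(1) by (rule inj_on_subset) (auto simp: A'_def)
    show "\<tau> ` A' \<subseteq> A" using \<tau>(2,3) unfolding A_def A'_def by blast
  qed simp
  moreover have "card A + card A' = card (G - {0})"
    unfolding A_def A'_def by (subst card_Un_disjoint[symmetric]) (auto intro!: arg_cong[where f = card])
  moreover have "card (G - {0}) = ?q\<^sup>2 - 1"
    using card_subspace[OF Gsub] gen[OF G] vec.subspace_0[OF Gsub] by simp
  ultimately have 2: "2 * card A = ?q\<^sup>2 - 1" by linarith
  define S where "S = cone_points Q W C \<inter> proj_points G"
  \<comment> \<open>Closure of \<open>C\<close> under nonzero scalars makes \<open>A\<close> a union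
    of whole punctured points.\<close>
  have A: "A = (\<Union>P\<in>S. P - {0})"
  proof
    show "(\<Union>P\<in>S. P - {0}) \<subseteq> A" by (auto simp: S_def A_def cone_points_def proj_points_def)
    show "A \<subseteq> (\<Union>P\<in>S. P - {0})"
    proof
      fix v assume v: "v \<in> A"
      then have v': "v \<in> G" "v \<noteq> 0" "v \<in> C" "v \<in> W" "Q v = 0"
        using GW ts by (auto simp: A_def totally_singular_def)
      have "w \<in> C" if w: "w \<in> vec.span {v} - {0}" for w
      proof -
        obtain k where "w = k *s v" using w by (auto simp: vec.span_singleton)
        moreover from this have "k \<noteq> 0" using w by auto
        ultimately show ?thesis using scale v'(3) by blast
      qed
      then have "vec.span {v} - {0} \<subseteq> C" by blast
      moreover have "vec.span {v} \<in> quadric Q G"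
        using span_singleton_in_quadric[OF Gsub] v' by blast
      moreover have "vec.span {v} \<in> quadric Q W"
        using span_singleton_in_quadric[OF W] v' by blast
      ultimately have "vec.span {v} \<in> S" by (auto simp: S_def cone_points_def quadric_def)
      then show "v \<in> (\<Union>P\<in>S. P - {0})" using v' by (auto intro!: vec.span_base)
    qed
  qed
  have "card A = (\<Sum>P\<in>S. card (P - {0}))"
    unfolding A
  proof (rule card_UN_disjoint)
    show "\<forall>P\<in>S. \<forall>P'\<in>S. P \<noteq> P' \<longrightarrow> (P - {0}) \<inter> (P' - {0}) = {}"
    proof (intro ballI impI)
      fix P P' assume "P \<in> S" "P' \<in> S" "P \<noteq> P'"
      then show "(P - {0}) \<inter> (P' - {0}) = {}"
        using proj_point_eq_span[of P G] proj_point_eq_span[of P' G] by (auto simp: S_def)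
    qed
  qed auto
  also have "\<dots> = (\<Sum>P\<in>S. ?q - 1)"
  proof (rule sum.cong)
    fix P assume "P \<in> S"
    then have P: "vec.subspace P" "vec.dim P = 1" by (auto simp: S_def proj_points_def)
    then show "card (P - {0}) = ?q - 1"
      using card_subspace[OF P(1)] vec.subspace_0[OF P(1)] by simp
  qed simp
  finally have "card A = card S * (?q - 1)" by simp
  moreover have "?q\<^sup>2 - 1 = (?q + 1) * (?q - 1)"
    using q by (simp add: power2_eq_square algebra_simps)
  ultimately have "(2 * card S) * (?q - 1) = (?q + 1) * (?q - 1)" using 2 by simp
  then have "2 * card S = ?q + 1" using q by (subst (asm) mult_cancel2) simp
  then show "card (cone_points Q W C \<inter> proj_points G) = (?q + 1) div 2"
    unfolding S_def by presburger
qed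

end

text \<open>The intersection has dimension at least 4 + 6 - 8 = 2, which is already the Witt index
  of \<open>W\<close>.\<close>

lemma generator_Int_elliptic_section:
  fixes Q :: "'a::{field,finite} ^ 8 \<Rightarrow> 'a"
  assumes Q: "hyperbolic_form Q" and W: "elliptic_section Q W" and G: "G \<in> generators Q UNIV"
  shows "G \<inter> W \<in> generators Q W"
proof -
  interpret quadratic_space Q using Q by unfold_locales (simp add: hyperbolic_form_def)
  have ts: "totally_singular Q G" using G by (simp add: generators_def)
  have sub: "vec.subspace G" "vec.subspace W"
    using ts W by (auto simp: totally_singular_def elliptic_section_def)
  have "vec.dim G = 4"
    using witt_index_eq_dim_generator[OF G] Q by (simp add: hyperbolic_form_def)
  moreover have "vec.dim W = 6" "witt_index Q W = 2" using W by (auto simp: elliptic_section_def)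
  moreover have "vec.dim {x + y |x y. x \<in> G \<and> y \<in> W} \<le> 8"
    using dim_subset_UNIV_cart_gen[of "{x + y |x y. x \<in> G \<and> y \<in> W}"] by simp
  ultimately have "witt_index Q W \<le> vec.dim (G \<inter> W)" using vec.dim_sums_Int[OF sub] by linarith
  moreover have "totally_singular Q (G \<inter> W)"
    using ts sub by (auto simp: totally_singular_def vec.subspace_inter)
  ultimately show ?thesis by (intro generatorI) auto
qed

lemma is_ovoid_Un_elliptic_sections:
  fixes Q :: "'a::{field,finite} ^ 8 \<Rightarrow> 'a"
  assumes Q: "hyperbolic_form Q" and W: "elliptic_section Q W" "elliptic_section Q W'"
    and S: "is_ovoid m Q W S" "is_ovoid m' Q W' S'" and disj: "S \<inter> S' = {}"
  shows "is_ovoid (m + m') Q UNIV (S \<union> S')"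
  unfolding is_ovoid_def
proof (intro conjI ballI)
  show "S \<union> S' \<subseteq> quadric Q UNIV"
    using S by (auto simp: is_ovoid_def quadric_def proj_points_def)
next
  fix G assume G: "G \<in> generators Q UNIV"
  have eq: "R \<inter> proj_points G = R \<inter> proj_points (G \<inter> V)" if "is_ovoid k Q V R" for R V k
    using that by (auto simp: is_ovoid_def quadric_def proj_points_def)
  have "card (S \<inter> proj_points G) = m"
    using eq[OF S(1)] S(1) generator_Int_elliptic_section[OF Q W(1) G] by (simp add: is_ovoid_def)
  moreover have "card (S' \<inter> proj_points G) = m'"
    using eq[OF S(2)] S(2) generator_Int_elliptic_section[OF Q W(2) G] by (simp add: is_ovoid_def)
  moreover have "card ((S \<union> S') \<inter> proj_points G) = card (S \<inter> proj_points G) + card (S' \<inter> proj_points G)"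
    unfolding Int_Un_distrib2 by (rule card_Un_disjoint) (use disj in auto)
  ultimately show "card ((S \<union> S') \<inter> proj_points G) = m + m'" by simp
qed

section \<open>Two elliptic sections of the hyperbolic quadric\<close>

text \<open>The bilinear form \<open>re (z * k)\<close> is nondegenerate; testing 1 and \<epsilon>
  gives \<open>re z = 0\<close> and \<open>ext_norm * im z = 0\<close>.\<close>

lemma re_mult_zero_imp_zero:
  fixes z :: "'a::{field,finite} quad"
  assumes "(2::'a) \<noteq> 0" "\<And>k. re (z * k) = 0"
  shows "z = 0"
proof -
  have "\<not> is_sq (ext_norm :: 'a)" by (rule ext_norm_nonsquare[OF assms(1)])
  then have "(ext_norm :: 'a) \<noteq> 0" by (auto simp: is_sq_def)
  then show ?thesis using assms(2)[of 1] assms(2)[of eps] by (auto simp: quad_eq_iff quad_sel_mult)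
qed

text \<open>Coordinates with respect to \<open>e\<close> and \<open>f\<close> turn \<open>Q\<close>
  into the standard sum of four products.\<close>

locale hyperbolic_pairs = quadratic_space Q + odd_finite_field "TYPE('a)"
  for Q :: "'a::{field,finite} ^ 8 \<Rightarrow> 'a" +
  fixes e f :: "4 \<Rightarrow> 'a ^ 8"
  assumes ef: "B (e i) (f j) = (if i = j then 1 else 0)"
    and ee: "B (e i) (e j) = 0" and ff: "B (f i) (f j) = 0"
begin

text \<open>
  The image of the embedding with parameter \<open>s\<close> is the image of the one with parameter \<open>0\<close> under
  the isometry that fixes all \<open>f\<^sub>i\<close>, \<open>e\<^sub>1\<close> and \<open>e\<^sub>2\<close> and maps \<open>e\<^sub>3\<close> to \<open>e\<^sub>3 + s f\<^sub>4\<close>, \<open>e\<^sub>4\<close> to \<open>e\<^sub>4 - s f\<^sub>3\<close>.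
\<close>

definition conic_embed :: "'a \<Rightarrow> 'a quad ^ 3 \<Rightarrow> 'a ^ 8" where
  "conic_embed s x = re (x $ 1) *s e 1 - re (x $ 3) *s f 1 + im (x $ 1) *s e 2 + (ext_norm * im (x $ 3)) *s f 2
     + re (x $ 2) *s (e 3 + f 3 + s *s f 4) + im (x $ 2) *s (e 4 - ext_norm *s f 4 - s *s f 3)"

lemma fe: "B (f i) (e j) = (if i = j then 1 else 0)"
  using ef[of j i] B_commute by auto

lemma four_distinct:
  "(1::4) \<noteq> 2" "(1::4) \<noteq> 3" "(1::4) \<noteq> 4" "(2::4) \<noteq> 3" "(2::4) \<noteq> 4" "(3::4) \<noteq> 4"
  by simp_all

text \<open>These six values determine \<open>x\<close> and do not involve \<open>s\<close>, so
  embeddings with different parameters agree only at equal arguments.\<close>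

lemma conic_embed_coords:
  "B (conic_embed s x) (f 1) = re (x $ 1)" "B (conic_embed s x) (f 2) = im (x $ 1)"
  "B (conic_embed s x) (f 3) = re (x $ 2)" "B (conic_embed s x) (f 4) = im (x $ 2)"
  "B (conic_embed s x) (e 1) = - re (x $ 3)" "B (conic_embed s x) (e 2) = ext_norm * im (x $ 3)"
  by (simp_all add: conic_embed_def B_add B_diff B_scale ef fe ee ff four_distinct four_distinct[symmetric])

lemma conic_embed_coords':
  "B (conic_embed s x) (e 3) = re (x $ 2) - s * im (x $ 2)"
  "B (conic_embed s x) (e 4) = s * re (x $ 2) - ext_norm * im (x $ 2)"
  by (simp_all add: conic_embed_def B_add B_diff B_scale ef fe ee ff four_distinct four_distinct[symmetric] algebra_simps)

text \<open>The terms with \<open>s\<close> cancel, so every parameter induces the same form on the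
  domain.\<close>

lemma B_conic_embed: "B (conic_embed s x) (conic_embed s y) = re (conic_polar x y)"
proof -
  have "B (conic_embed s x) (conic_embed s y) =
    re (y $ 1) * B (conic_embed s x) (e 1) - re (y $ 3) * B (conic_embed s x) (f 1)
    + im (y $ 1) * B (conic_embed s x) (e 2) + ext_norm * im (y $ 3) * B (conic_embed s x) (f 2)
    + re (y $ 2) * (B (conic_embed s x) (e 3) + B (conic_embed s x) (f 3) + s * B (conic_embed s x) (f 4))
    + im (y $ 2) * (B (conic_embed s x) (e 4) - ext_norm * B (conic_embed s x) (f 4) - s * B (conic_embed s x) (f 3))"
    by (simp add: conic_embed_def[of s y] B_add B_diff B_scale algebra_simps)
  also have "\<dots> = re (conic_polar x y)"
    unfolding conic_embed_coords conic_embed_coords'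
    by (simp add: conic_polar_def quad_sel_mult algebra_simps)
  finally show ?thesis .
qed

lemma Q_conic_embed: "Q (conic_embed s x) = re (conic_form x)"
proof -
  have "2 * Q (conic_embed s x) = 2 * re (conic_form x)"
    using B_conic_embed[of s x x] by (simp add: B_self conic_polar_self quad_sel_mult)
  then show ?thesis using two_neq_zero by simp
qed

lemma ext_norm_neq_zero: "(ext_norm :: 'a) \<noteq> 0"
  using ext_norm_nonsquare[OF two_neq_zero] by (auto simp: is_sq_def)

lemma conic_embed_eq:
  assumes "conic_embed s x = conic_embed t y"
  shows "x = y"
  using conic_embed_coords[of s x] conic_embed_coords[of t y] ext_norm_neq_zero
  unfolding assms by (simp add: vec3_eq_iff quad_eq_iff)

lemma inj_conic_embed: "inj (conic_embed s)"
  using conic_embed_eq by (rule injI)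

lemma conic_embed_add: "conic_embed s (x + y) = conic_embed s x + conic_embed s y"
  by (simp add: conic_embed_def vec_eq_iff algebra_simps)

lemma conic_embed_scale: "conic_embed s (emb c *s x) = c *s conic_embed s x"
  by (simp add: conic_embed_def vec_eq_iff algebra_simps)

lemma conic_embed_0 [simp]: "conic_embed s 0 = 0"
  by (simp add: conic_embed_def)

lemma subspace_conic_embed:
  assumes "0 \<in> X" "\<And>x y. x \<in> X \<Longrightarrow> y \<in> X \<Longrightarrow> x + y \<in> X" "\<And>c x. x \<in> X \<Longrightarrow> emb c *s x \<in> X"
  shows "vec.subspace (conic_embed s ` X)"
  unfolding vec.subspace_def
proof (intro conjI ballI allI)
  show "0 \<in> conic_embed s ` X" using assms(1) conic_embed_0 by (metis imageI)
  show "v + w \<in> conic_embed s ` X" if "v \<in> conic_embed s ` X" "w \<in> conic_embed s ` X" for v w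
    using that assms(2) by (auto simp flip: conic_embed_add)
  show "c *s v \<in> conic_embed s ` X" if "v \<in> conic_embed s ` X" for c v
    using that assms(3) by (auto simp flip: conic_embed_scale)
qed

lemma card_field_gt_1: "CARD('a) > 1"
  using card_mono[of "UNIV :: 'a set" "{0, 1}"] by simp

lemma dim_conic_embed:
  assumes "vec.subspace (conic_embed s ` X)" "card X = CARD('a) ^ d"
  shows "vec.dim (conic_embed s ` X) = d"
proof -
  have "CARD('a) ^ vec.dim (conic_embed s ` X) = CARD('a) ^ d"
    using card_subspace[OF assms(1)] assms(2)
    by (simp add: card_image inj_on_subset[OF inj_conic_embed])
  then show ?thesis using card_field_gt_1 power_inject_exp by blast
qed

lemma subspace_section: "vec.subspace (range (conic_embed s))"
  by (rule subspace_conic_embed) auto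

text \<open>One generator suffices to fix the Witt index. The K-line through the conic point (0, 0,
  1) is maximal: orthogonality to it forces \<open>x $ 1 = 0\<close>, and then singularity with
  \<open>x $ 2\<close> nonzero would make \<open>ext_norm\<close> a square.\<close>

lemma ex_generator_dim_2: "\<exists>G\<in>generators Q (range (conic_embed s)). vec.dim G = 2"
proof -
  let ?X = "{x :: 'a quad ^ 3. x $ 1 = 0 \<and> x $ 2 = 0}"
  let ?M = "conic_embed s ` ?X"
  have sub: "vec.subspace ?M" by (rule subspace_conic_embed) auto
  have "?X = range (axis 3)" by (auto simp: vec3_eq_iff axis_def image_iff)
  moreover have "inj (axis 3 :: 'a quad \<Rightarrow> 'a quad ^ 3)" by (auto simp: inj_def axis_eq_axis)
  ultimately have "card ?X = CARD('a)\<^sup>2" by (simp add: card_image card_quad)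
  then have dim: "vec.dim ?M = 2" using dim_conic_embed[OF sub] by blast
  have ts: "totally_singular Q ?M"
    using sub by (auto simp: totally_singular_def Q_conic_embed conic_form_def)
  have "U = ?M" if U: "?M \<subseteq> U" "U \<subseteq> range (conic_embed s)" "totally_singular Q U" for U
  proof (rule antisym[OF _ U(1)], rule subsetI)
    fix v assume v: "v \<in> U"
    then obtain x where x: "v = conic_embed s x" using U(2) by blast
    have "re (- x $ 1 * k) = 0" for k
    proof -
      have "conic_embed s (axis 3 k) \<in> U" using U(1) by (auto simp: axis_def)
      then have "B v (conic_embed s (axis 3 k)) = 0" using totally_singular_B[OF U(3) v] by blast
      then show ?thesis by (simp add: x B_conic_embed conic_polar_def axis_def)
    qed
    then have 1: "x $ 1 = 0" using re_mult_zero_imp_zero[OF two_neq_zero] by (metis neg_equal_0_iff_equal)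
    have "Q v = 0" using U(3) v by (simp add: totally_singular_def)
    then have sq: "(re (x $ 2))\<^sup>2 = (im (x $ 2))\<^sup>2 * ext_norm"
      by (simp add: x Q_conic_embed conic_form_def 1 power2_eq_square quad_sel_mult algebra_simps)
    have "im (x $ 2) = 0"
    proof (rule ccontr)
      assume "im (x $ 2) \<noteq> 0"
      then have "is_sq (ext_norm :: 'a)"
        using sq is_sq_mult_square_iff[of "im (x $ 2)" ext_norm] by (metis is_sq_def)
      then show False using ext_norm_nonsquare[OF two_neq_zero] by blast
    qed
    then have "x $ 2 = 0" using sq by (simp add: quad_eq_iff)
    then show "v \<in> ?M" using x 1 by blast
  qed
  then have "?M \<in> generators Q (range (conic_embed s))"
    using ts by (auto simp: generators_def)
  then show ?thesis using dim by blast
qed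

lemma elliptic_section_conic_embed: "elliptic_section Q (range (conic_embed s))"
  unfolding elliptic_section_def
proof (intro conjI)
  show sub: "vec.subspace (range (conic_embed s))" by (rule subspace_section)
  have "CARD('a quad ^ 3) = CARD('a) ^ 6" by (simp add: card_quad flip: power_mult)
  then show "vec.dim (range (conic_embed s)) = 6" by (rule dim_conic_embed[OF sub])
  obtain G where "G \<in> generators Q (range (conic_embed s))" "vec.dim G = 2"
    using ex_generator_dim_2 by blast
  then show "witt_index Q (range (conic_embed s)) = 2"
    using witt_index_eq_dim_generator[OF _ sub] by metis
  show "nonsingular_on Q (range (conic_embed s))"
    unfolding nonsingular_on_def
  proof (intro ballI impI, elim conjE)
    fix v assume "v \<in> range (conic_embed s)" and orth: "\<forall>w\<in>range (conic_embed s). B v w = 0"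
    then obtain x where x: "v = conic_embed s x" by blast
    have polar: "re (conic_polar x y) = 0" for y using orth by (simp add: x B_conic_embed)
    \<comment> \<open>Pairing with the multiples of each unit vector of K^3 isolates one coordinate
      at a time.\<close>
    have "re (- x $ 3 * k) = 0" for k using polar[of "axis 1 k"] by (simp add: conic_polar_def axis_def)
    then have "x $ 3 = 0" using re_mult_zero_imp_zero[OF two_neq_zero] by (metis neg_equal_0_iff_equal)
    moreover have "re (- x $ 1 * k) = 0" for k using polar[of "axis 3 k"] by (simp add: conic_polar_def axis_def)
    then have "x $ 1 = 0" using re_mult_zero_imp_zero[OF two_neq_zero] by (metis neg_equal_0_iff_equal)
    moreover have "re (x $ 2 * k) = 0" for k
      using polar[of "axis 2 k"] two_neq_zero by (simp add: conic_polar_def axis_def quad_sel_mult algebra_simps)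
    then have "x $ 2 = 0" by (rule re_mult_zero_imp_zero[OF two_neq_zero])
    ultimately have "x = 0" by (simp add: vec3_eq_iff)
    then show "v = 0" by (simp add: x)
  qed
qed

text \<open>A generator is pulled back to K^3, where the exchange map exists, and the map is
  transported along the embedding. Its property is symmetric under complement, so both choices of
  \<open>H\<close> work.\<close>

lemma is_ovoid_half_cone:
  assumes H: "H = half_cone \<or> H = - half_cone"
  shows "is_ovoid ((CARD('a) + 1) div 2) Q (range (conic_embed s))
    (cone_points Q (range (conic_embed s)) (conic_embed s ` H))"
proof (rule is_ovoid_cone_points)
  show sub: "vec.subspace (range (conic_embed s))" by (rule subspace_section)
  show "vec.dim G = 2" if "G \<in> generators Q (range (conic_embed s))" for G
    using witt_index_eq_dim_generator[OF that sub] elliptic_section_conic_embed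
    by (simp add: elliptic_section_def)
  show "c *s v \<in> conic_embed s ` H" if cv: "c \<noteq> 0" "v \<in> conic_embed s ` H" for c v
  proof -
    obtain x where x: "x \<in> H" "v = conic_embed s x" using cv(2) by blast
    then have "emb c *s x \<in> H" using H half_cone_scale[OF cv(1), of x] by auto
    then show ?thesis using x by (metis conic_embed_scale imageI)
  qed
  fix L :: "('a ^ 8) set"
  assume L: "totally_singular Q L" "L \<subseteq> range (conic_embed s)" "vec.dim L = 2"
  then have Lsub: "vec.subspace L" by (simp add: totally_singular_def)
  let ?L = "conic_embed s -` L"
  have "\<exists>\<tau>. inj_on \<tau> (?L - {0}) \<and> \<tau> ` (?L - {0}) \<subseteq> ?L - {0} \<and>
    (\<forall>x\<in>?L - {0}. \<tau> x \<in> half_cone \<longleftrightarrow> x \<notin> half_cone)"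
  proof (rule half_cone_swap)
    show "x + y \<in> ?L" if "x \<in> ?L" "y \<in> ?L" for x y
      using that vec.subspace_add[OF Lsub] by (simp add: conic_embed_add)
    show "emb a *s x \<in> ?L" if "x \<in> ?L" for a x
      using that vec.subspace_scale[OF Lsub] by (simp add: conic_embed_scale)
    show "card ?L = CARD('a)\<^sup>2"
      using card_vimage_inj[OF inj_conic_embed L(2)] card_subspace[OF Lsub] L(3) by simp
    show "re (conic_form x) = 0" if "x \<in> ?L" for x
      using that L(1) by (simp add: totally_singular_def flip: Q_conic_embed[of s])
  qed
  then obtain \<tau> where \<tau>: "inj_on \<tau> (?L - {0})" "\<tau> ` (?L - {0}) \<subseteq> ?L - {0}"
    and swap: "\<forall>x\<in>?L - {0}. \<tau> x \<in> half_cone \<longleftrightarrow> x \<notin> half_cone"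
    by (elim exE conjE) (rule that)
  have \<tau>_H: "\<tau> x \<in> H \<longleftrightarrow> x \<notin> H" if "x \<in> ?L - {0}" for x
    using H bspec[OF swap that] by blast
  have L_eq: "L - {0} = conic_embed s ` (?L - {0})"
  proof
    show "L - {0} \<subseteq> conic_embed s ` (?L - {0})"
    proof
      fix v assume v: "v \<in> L - {0}"
      then obtain x where "v = conic_embed s x" using L(2) by blast
      moreover from this have "x \<noteq> 0" using v by auto
      ultimately show "v \<in> conic_embed s ` (?L - {0})" using v by auto
    qed
    show "conic_embed s ` (?L - {0}) \<subseteq> L - {0}"
      using conic_embed_eq[of s _ s 0] by auto
  qed
  let ?t = "\<lambda>v. conic_embed s (\<tau> (inv (conic_embed s) v))"
  have t: "?t (conic_embed s x) = conic_embed s (\<tau> x)" for x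
    by (simp add: inv_f_f[OF inj_conic_embed])
  have "inj_on ?t (L - {0})"
  proof (rule inj_onI)
    fix v w assume "v \<in> L - {0}" "w \<in> L - {0}" and eq: "?t v = ?t w"
    then obtain x y where x: "x \<in> ?L - {0}" "v = conic_embed s x"
      and y: "y \<in> ?L - {0}" "w = conic_embed s y"
      unfolding L_eq by blast
    have "\<tau> x = \<tau> y" using eq conic_embed_eq unfolding x(2) y(2) t by blast
    then have "x = y" using inj_onD[OF \<tau>(1)] x(1) y(1) by blast
    then show "v = w" using x(2) y(2) by simp
  qed
  moreover have "?t ` (L - {0}) \<subseteq> L - {0}"
  proof -
    have "?t ` (L - {0}) = conic_embed s ` \<tau> ` (?L - {0})"
      unfolding L_eq by (simp only: image_image t)
    then show ?thesis using image_mono[OF \<tau>(2), of "conic_embed s"] L_eq by simp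
  qed
  moreover have "\<forall>v\<in>L - {0}. ?t v \<in> conic_embed s ` H \<longleftrightarrow> v \<notin> conic_embed s ` H"
  proof
    fix v assume "v \<in> L - {0}"
    then obtain x where x: "x \<in> ?L - {0}" and v: "v = conic_embed s x" unfolding L_eq by blast
    show "?t v \<in> conic_embed s ` H \<longleftrightarrow> v \<notin> conic_embed s ` H"
      unfolding v t inj_image_mem_iff[OF inj_conic_embed] by (rule \<tau>_H[OF x])
  qed
  ultimately show "\<exists>\<tau>. inj_on \<tau> (L - {0}) \<and> \<tau> ` (L - {0}) \<subseteq> L - {0} \<and>
      (\<forall>v\<in>L - {0}. \<tau> v \<in> conic_embed s ` H \<longleftrightarrow> v \<notin> conic_embed s ` H)" by blast
qed

lemma quadric_conic_embed_distinct:
  "quadric Q (range (conic_embed 0)) \<noteq> quadric Q (range (conic_embed 1))"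
proof
  assume eq: "quadric Q (range (conic_embed 0)) = quadric Q (range (conic_embed 1))"
  \<comment> \<open>The all-ones vector, a point of the conic with \<open>re (x $ 2) = 1\<close>:
    pairing its images with \<open>e 4\<close> gives 0 for parameter 0 and 1 for parameter
    1.\<close>
  define x :: "'a quad ^ 3" where "x = 1"
  define v where "v = conic_embed 0 x"
  have "x \<noteq> 0" "conic_form x = 0" by (simp_all add: x_def conic_form_def)
  then have "Q v = 0" "v \<noteq> 0"
    using conic_embed_eq[of 0 x 0 0] by (auto simp: v_def Q_conic_embed)
  then have "vec.span {v} \<in> quadric Q (range (conic_embed 0))"
    by (intro span_singleton_in_quadric subspace_section) (auto simp: v_def)
  then have "vec.span {v} \<subseteq> range (conic_embed 1)"
    unfolding eq by (simp add: quadric_def proj_points_def)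
  then obtain y where "v = conic_embed 1 y" using vec.span_base[of v "{v}"] by blast
  moreover from this have "x = y" unfolding v_def by (rule conic_embed_eq)
  ultimately have "conic_embed 0 x = conic_embed 1 x" by (simp add: v_def)
  then have "B (conic_embed 0 x) (e 4) = B (conic_embed 1 x) (e 4)" by simp
  then show False by (simp add: conic_embed_coords' x_def)
qed

lemma disjoint_cone_points:
  "cone_points Q (range (conic_embed s)) (conic_embed s ` H) \<inter>
   cone_points Q (range (conic_embed t)) (conic_embed t ` (- H)) = {}"
proof (rule ccontr)
  assume "\<not> ?thesis"
  then obtain P where "P \<in> cone_points Q (range (conic_embed s)) (conic_embed s ` H)"
    "P \<in> cone_points Q (range (conic_embed t)) (conic_embed t ` (- H))" by blast
  then have P: "P \<in> proj_points (range (conic_embed s))"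
    "P - {0} \<subseteq> conic_embed s ` H" "P - {0} \<subseteq> conic_embed t ` (- H)"
    by (simp_all add: cone_points_def quadric_def)
  obtain v where "v \<in> P" "v \<noteq> 0" using proj_points_ex_nonzero[OF P(1)] by blast
  then obtain x y where "x \<in> H" "y \<notin> H" "conic_embed s x = conic_embed t y" using P by blast
  then show False using conic_embed_eq by metis
qed

end

theorem theorem4p4:
  fixes Q :: "('a::{field,finite}) ^ 8 \<Rightarrow> 'a" and q :: nat
  assumes "CARD('a) = q" and "odd q" and "hyperbolic_form Q"
  shows "\<exists>W1 W2 O1 O2.
           elliptic_section Q W1 \<and> elliptic_section Q W2 \<and>
           quadric Q W1 \<noteq> quadric Q W2 \<and>
           is_ovoid ((q + 1) div 2) Q W1 O1 \<and>
           is_ovoid ((q + 1) div 2) Q W2 O2 \<and>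
           is_ovoid (q + 1) Q UNIV (O1 \<union> O2)"
proof -
  have two: "(2::'a) \<noteq> 0" using assms two_neq_zero_of_odd_card by blast
  interpret quadratic_space Q using assms(3) by unfold_locales (simp add: hyperbolic_form_def)
  have ns: "nonsingular_on Q UNIV" using assms(3) by (simp add: hyperbolic_form_def)
  obtain M where M: "totally_singular Q M" "vec.dim M = 4"
    using ex_totally_singular_dim_witt_index[of UNIV] assms(3) by (auto simp: hyperbolic_form_def)
  obtain E where E: "E \<subseteq> M" "vec.independent E" "M \<subseteq> vec.span E" "card E = 4"
    using vec.basis_exists[of M] M(2) by metis
  have "finite E" using E(2) by (rule vec.finiteI_independent)
  \<comment> \<open>A basis of a maximal totally singular subspace, indexed by the type
    \<open>4\<close>, becomes one half of the hyperbolic pairs.\<close>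
  then obtain e :: "4 \<Rightarrow> 'a ^ 8" where "bij_betw e UNIV E"
    using finite_same_card_bij[of "UNIV :: 4 set" E] E(4) by auto
  then have e: "inj e" "range e = E" by (auto simp: bij_betw_def)
  have "vec.span E = M"
    using E M(1) vec.span_minimal[of E M] by (auto simp: totally_singular_def)
  then obtain f where f: "\<forall>i j. B (e i) (f j) = (if i = j then 1 else 0)"
    "\<forall>i j. B (e i) (e j) = 0" "\<forall>i j. B (f i) (f j) = 0"
    using ex_hyperbolic_pairs[OF two ns e(1)] E(2) M(1) e(2) by metis
  interpret hyperbolic_pairs Q e f using two f by unfold_locales auto
  let ?W = "\<lambda>s. range (conic_embed s)"
  let ?O1 = "cone_points Q (?W 0) (conic_embed 0 ` half_cone)"
  let ?O2 = "cone_points Q (?W 1) (conic_embed 1 ` (- half_cone))"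
  have O1: "is_ovoid ((q + 1) div 2) Q (?W 0) ?O1"
    using is_ovoid_half_cone[of half_cone 0] assms(1) by simp
  have O2: "is_ovoid ((q + 1) div 2) Q (?W 1) ?O2"
    using is_ovoid_half_cone[of "- half_cone" 1] assms(1) by simp
  have "is_ovoid ((q + 1) div 2 + (q + 1) div 2) Q UNIV (?O1 \<union> ?O2)"
    using is_ovoid_Un_elliptic_sections[OF assms(3) elliptic_section_conic_embed
        elliptic_section_conic_embed O1 O2 disjoint_cone_points] .
  \<comment> \<open>Oddness of \<open>q\<close> makes the halving exact.\<close>
  moreover have "(q + 1) div 2 + (q + 1) div 2 = q + 1" using assms(2) by presburger
  ultimately show ?thesis
    using elliptic_section_conic_embed quadric_conic_embed_distinct O1 O2 by metis
qed

end
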